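(* Let $\mathbb{A}$ be the field of real algebraic numbers. $T[\mathbb{R}]$ is a conservative extension of $T[\mathbb{A}]$: every sentence in the language of $T[\mathbb{A}]$ that is provable in $T[\mathbb{R}]$ is provable in $T[\mathbb{A}]$.
   Context: For a subfield $F$ of $\mathbb{R}$ and $a\in F$, $f_a$ is a unary function symbol interpreted as $f_a(x)=ax$. $T_{\mathrm{add}}[F]$ is the set of sentences true in $(\mathbb{R},0,1,+,-,<,(f_a)_{a\in F})$, $T_{\mathrm{mult}}[F]$ the set of sentences true in $(\mathbb{R},0,1,\times,\div,<,(f_a)_{a\in F})$ with $x\div0=0$, and $T[F]=T_{\mathrm{add}}[F]\cup T_{\mathrm{mult}}[F]$, a theory in the union of the two languages. *)

theory Defs
  imports Complex_Main "HOL-Computational_Algebra.Polynomial"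
begin

text \<open>Function symbols: constants 0, 1; binary +, - (subtraction), *, / (division,
  with x / 0 = 0); unary scalar multiplications f_a (a real).  The only relation
  symbol besides equality is <.\<close>

datatype fsym = Zero | One | Add | Sub | Mul | Dvd | Scal real

fun arity :: "fsym \<Rightarrow> nat" where
  "arity Zero = 0" | "arity One = 0" | "arity Add = 2" | "arity Sub = 2"
| "arity Mul = 2" | "arity Dvd = 2" | "arity (Scal a) = 1"

fun interp :: "fsym \<Rightarrow> real list \<Rightarrow> real" where
  "interp Zero xs = 0"
| "interp One xs = 1"
| "interp Add xs = xs ! 0 + xs ! 1"
| "interp Sub xs = xs ! 0 - xs ! 1"
| "interp Mul xs = xs ! 0 * xs ! 1"
| "interp Dvd xs = xs ! 0 / xs ! 1"
| "interp (Scal a) xs = a * xs ! 0"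

definition L_add :: "real set \<Rightarrow> fsym set" where
  "L_add F = {Zero, One, Add, Sub} \<union> Scal ` F"
definition L_mult :: "real set \<Rightarrow> fsym set" where
  "L_mult F = {Zero, One, Mul, Dvd} \<union> Scal ` F"
definition L_full :: "real set \<Rightarrow> fsym set" where
  "L_full F = L_add F \<union> L_mult F"

datatype trm = Var nat | App fsym "trm list"

datatype fm = FF | Eq trm trm | Less trm trm | Imp fm fm | All fm

fun wf_trm :: "fsym set \<Rightarrow> trm \<Rightarrow> bool" where
  "wf_trm L (Var n) = True"
| "wf_trm L (App f ts) = (f \<in> L \<and> length ts = arity f \<and> (\<forall>t\<in>set ts. wf_trm L t))"

fun wf_fm :: "fsym set \<Rightarrow> fm \<Rightarrow> bool" where
  "wf_fm L FF = True"
| "wf_fm L (Eq s t) = (wf_trm L s \<and> wf_trm L t)"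
| "wf_fm L (Less s t) = (wf_trm L s \<and> wf_trm L t)"
| "wf_fm L (Imp p q) = (wf_fm L p \<and> wf_fm L q)"
| "wf_fm L (All p) = wf_fm L p"

fun closed_trm :: "nat \<Rightarrow> trm \<Rightarrow> bool" where
  "closed_trm k (Var n) = (n < k)"
| "closed_trm k (App f ts) = (\<forall>t\<in>set ts. closed_trm k t)"

fun closed_fm :: "nat \<Rightarrow> fm \<Rightarrow> bool" where
  "closed_fm k FF = True"
| "closed_fm k (Eq s t) = (closed_trm k s \<and> closed_trm k t)"
| "closed_fm k (Less s t) = (closed_trm k s \<and> closed_trm k t)"
| "closed_fm k (Imp p q) = (closed_fm k p \<and> closed_fm k q)"
| "closed_fm k (All p) = closed_fm (Suc k) p"

definition sentence :: "fsym set \<Rightarrow> fm \<Rightarrow> bool" where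
  "sentence L p \<longleftrightarrow> wf_fm L p \<and> closed_fm 0 p"

fun lift_trm :: "nat \<Rightarrow> trm \<Rightarrow> trm" where
  "lift_trm k (Var n) = (if n < k then Var n else Var (Suc n))"
| "lift_trm k (App f ts) = App f (map (lift_trm k) ts)"

fun lift_fm :: "nat \<Rightarrow> fm \<Rightarrow> fm" where
  "lift_fm k FF = FF"
| "lift_fm k (Eq s t) = Eq (lift_trm k s) (lift_trm k t)"
| "lift_fm k (Less s t) = Less (lift_trm k s) (lift_trm k t)"
| "lift_fm k (Imp p q) = Imp (lift_fm k p) (lift_fm k q)"
| "lift_fm k (All p) = All (lift_fm (Suc k) p)"

fun subst_trm :: "nat \<Rightarrow> trm \<Rightarrow> trm \<Rightarrow> trm" where
  "subst_trm k s (Var n) = (if n < k then Var n else if n = k then s else Var (n - 1))"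
| "subst_trm k s (App f ts) = App f (map (subst_trm k s) ts)"

fun subst_fm :: "nat \<Rightarrow> trm \<Rightarrow> fm \<Rightarrow> fm" where
  "subst_fm k s FF = FF"
| "subst_fm k s (Eq a b) = Eq (subst_trm k s a) (subst_trm k s b)"
| "subst_fm k s (Less a b) = Less (subst_trm k s a) (subst_trm k s b)"
| "subst_fm k s (Imp p q) = Imp (subst_fm k s p) (subst_fm k s q)"
| "subst_fm k s (All p) = All (subst_fm (Suc k) (lift_trm 0 s) p)"

definition shift_env :: "real \<Rightarrow> (nat \<Rightarrow> real) \<Rightarrow> nat \<Rightarrow> real" where
  "shift_env x e = (\<lambda>n. case n of 0 \<Rightarrow> x | Suc m \<Rightarrow> e m)"

fun teval :: "(nat \<Rightarrow> real) \<Rightarrow> trm \<Rightarrow> real" where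
  "teval e (Var n) = e n"
| "teval e (App f ts) = interp f (map (teval e) ts)"

fun holds :: "(nat \<Rightarrow> real) \<Rightarrow> fm \<Rightarrow> bool" where
  "holds e FF = False"
| "holds e (Eq s t) = (teval e s = teval e t)"
| "holds e (Less s t) = (teval e s < teval e t)"
| "holds e (Imp p q) = (holds e p \<longrightarrow> holds e q)"
| "holds e (All p) = (\<forall>x. holds (shift_env x e) p)"

definition T_add :: "real set \<Rightarrow> fm set" where
  "T_add F = {p. sentence (L_add F) p \<and> (\<forall>e. holds e p)}"
definition T_mult :: "real set \<Rightarrow> fm set" where
  "T_mult F = {p. sentence (L_mult F) p \<and> (\<forall>e. holds e p)}"
definition T_full :: "real set \<Rightarrow> fm set" where
  "T_full F = T_add F \<union> T_mult F"

inductive prov :: "fsym set \<Rightarrow> fm set \<Rightarrow> fm \<Rightarrow> bool" for L :: "fsym set" where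
  Hyp: "p \<in> \<Gamma> \<Longrightarrow> wf_fm L p \<Longrightarrow> prov L \<Gamma> p"
| AxK: "wf_fm L p \<Longrightarrow> wf_fm L q \<Longrightarrow> prov L \<Gamma> (Imp p (Imp q p))"
| AxS: "wf_fm L p \<Longrightarrow> wf_fm L q \<Longrightarrow> wf_fm L r \<Longrightarrow>
        prov L \<Gamma> (Imp (Imp p (Imp q r)) (Imp (Imp p q) (Imp p r)))"
| AxDN: "wf_fm L p \<Longrightarrow> prov L \<Gamma> (Imp (Imp (Imp p FF) FF) p)"
| MP: "prov L \<Gamma> (Imp p q) \<Longrightarrow> prov L \<Gamma> p \<Longrightarrow> prov L \<Gamma> q"
| Gen: "prov L \<Gamma> p \<Longrightarrow> (\<forall>q\<in>\<Gamma>. closed_fm 0 q) \<Longrightarrow> prov L \<Gamma> (All p)"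
| AxInst: "wf_fm L p \<Longrightarrow> wf_trm L t \<Longrightarrow> prov L \<Gamma> (Imp (All p) (subst_fm 0 t p))"
| AxVac: "wf_fm L p \<Longrightarrow> prov L \<Gamma> (Imp p (All (lift_fm 0 p)))"
| AxDist: "wf_fm L p \<Longrightarrow> wf_fm L q \<Longrightarrow>
        prov L \<Gamma> (Imp (All (Imp p q)) (Imp (All p) (All q)))"
| AxRefl: "wf_trm L t \<Longrightarrow> prov L \<Gamma> (Eq t t)"
| AxLeib: "wf_fm L p \<Longrightarrow> wf_trm L s \<Longrightarrow> wf_trm L t \<Longrightarrow>
        prov L \<Gamma> (Imp (Eq s t) (Imp (subst_fm 0 s p) (subst_fm 0 t p)))"

definition real_alg :: "real set" where
  "real_alg = {x. algebraic x}"

end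

theory Submission
  imports Defs
begin

text \<open>A proof in \<open>T[R]\<close> uses finitely many axioms, hence finitely many scalars. That those
  axioms are true says that the tuple of scalars satisfies a parameter-free first-order condition over
  the ordered field of reals, so by Tarski's theorem some tuple of algebraic numbers satisfies it as
  well, and the scalars that are already algebraic may be kept. Renaming the function symbols
  accordingly turns the proof into one in \<open>T[A]\<close>.

  Quantifier elimination is carried out semantically, in the style of Cohen and Hoermander. For
  every finite set of polynomials in \<open>x\<close> whose coefficients are integer polynomials in the parameters
  there are finitely many integer polynomials in the parameters such that, whenever these have the same
  signs at \<open>e\<close> and \<open>e'\<close>, an order automorphism of the line carries the sign pattern at \<open>e\<close> to
  that at \<open>e'\<close>.\<close>

section \<open>Matching the sign patterns of two polynomials\<close>

text \<open>Truth in the reals does not settle the claim directly: being true does not make a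
  sentence that mixes addition and multiplication provable from the two partial theories. For an
  axiom, by contrast, truth is all that is asked besides membership in one of the two languages, and
  renaming scalars respects each language separately. Hence derivations are transformed, and
  Tarski's theorem is applied to the axioms only. Algebraic numbers suffice because the sign of a
  nonzero integer polynomial in one variable is stable near every real that is not a root of it. Two
  obstacles shape the elimination: the coefficients depend on parameters, so formal degrees may
  drop, and one automorphism must serve several polynomials. A match found for the smaller problem
  is therefore corrected only by automorphisms that fix the roots of the other polynomials.\<close>

definition order_auto :: "(real \<Rightarrow> real) \<Rightarrow> bool" where
  "order_auto \<phi> \<longleftrightarrow> strict_mono \<phi> \<and> surj \<phi>"

lemma order_auto_id: "order_auto (\<lambda>x. x)"
  by (simp add: order_auto_def strict_mono_def)

lemma order_auto_comp: "order_auto \<phi> \<Longrightarrow> order_auto \<psi> \<Longrightarrow> order_auto (\<lambda>x. \<phi> (\<psi> x))"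
  unfolding order_auto_def strict_mono_def using comp_surj[of \<psi> \<phi>] by (auto simp: comp_def)

lemma order_auto_less_iff: "order_auto \<phi> \<Longrightarrow> \<phi> x < \<phi> y \<longleftrightarrow> x < y"
  unfolding order_auto_def using strict_mono_less by blast

text \<open>The map is the identity outside the interval and linear on either side of
  \<open>a\<close>; \<open>k\<close> and \<open>l\<close> are the two slopes.\<close>

lemma order_auto_shift_point:
  fixes u v a b :: real
  assumes "u < a" "a < v" "u < b" "b < v"
  shows "\<exists>\<theta>. order_auto \<theta> \<and> \<theta> a = b \<and> (\<forall>x. x \<le> u \<or> v \<le> x \<longrightarrow> \<theta> x = x)"
proof -
  define k l where "k = (b - u) / (a - u)" and "l = (v - b) / (v - a)"
  have kl: "k > 0" "l > 0" using assms by (auto simp: k_def l_def)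
  have ka: "(a - u) * k = b - u" and la: "(v - a) * l = v - b"
    using assms by (auto simp: k_def l_def)
  define \<theta> where "\<theta> x = (if x \<le> u \<or> v \<le> x then x else if x \<le> a then u + (x - u) * k else v - (v - x) * l)" for x
  have left: "u < \<theta> x \<and> \<theta> x \<le> b" if "u < x" "x \<le> a" for x
  proof -
    have "(x - u) * k \<le> (a - u) * k" using that kl by simp
    then show ?thesis using that kl ka assms by (auto simp: \<theta>_def)
  qed
  have right: "b < \<theta> x \<and> \<theta> x < v" if "a < x" "x < v" for x
  proof -
    have "(v - x) * l < (v - a) * l" using that kl by simp
    then show ?thesis using that kl la assms by (auto simp: \<theta>_def)
  qed
  have mono: "\<theta> x < \<theta> y" if "x < y" for x y
  proof -
    consider "x \<le> u" | "u < x" "y \<le> a" | "u < x" "x \<le> a" "a < y" "y < v" | "v \<le> y" | "a < x" "y < v"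
      using \<open>x < y\<close> by linarith
    then show ?thesis
    proof cases
      case 1 then show ?thesis using left[of y] right[of y] that assms
        by (cases "y \<le> u"; cases "y \<le> a"; cases "v \<le> y") (auto simp: \<theta>_def[of x] \<theta>_def[of y])
    next
      case 2 then show ?thesis using that kl assms by (auto simp: \<theta>_def)
    next
      case 3 then show ?thesis using left[of x] right[of y] by auto
    next
      case 4 then show ?thesis using left[of x] right[of x] that assms
        by (cases "x \<le> u"; cases "x \<le> a"; cases "v \<le> x") (auto simp: \<theta>_def[of x] \<theta>_def[of y])
    next
      case 5 then show ?thesis using that kl assms by (auto simp: \<theta>_def)
    qed
  qed
  have "\<exists>x. \<theta> x = y" for y
  proof -
    consider "y \<le> u \<or> v \<le> y" | "u < y" "y \<le> b" | "b < y" "y < v" by linarith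
    then show ?thesis
    proof cases
      case 1 then show ?thesis by (intro exI[of _ y]) (auto simp: \<theta>_def)
    next
      case 2
      have "(y - u) / k \<le> (b - u) / k" using 2 kl by (simp add: divide_right_mono)
      also have "\<dots> = a - u" using ka kl by (simp add: field_simps)
      finally have "(y - u) / k \<le> a - u" .
      moreover have "(y - u) / k > 0" using 2 kl by simp
      ultimately show ?thesis using assms kl by (intro exI[of _ "u + (y - u) / k"]) (auto simp: \<theta>_def)
    next
      case 3
      have "(v - y) / l < (v - b) / l" using 3 kl by (simp add: divide_strict_right_mono)
      also have "\<dots> = v - a" using la kl by (simp add: field_simps)
      finally have "(v - y) / l < v - a" .
      moreover have "(v - y) / l > 0" using 3 kl by simp
      ultimately show ?thesis using assms kl by (intro exI[of _ "v - (v - y) / l"]) (auto simp: \<theta>_def)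
    qed
  qed
  then have "order_auto \<theta>" unfolding order_auto_def strict_mono_def surj_def using mono by metis
  moreover have "\<theta> a = b" using assms ka by (simp add: \<theta>_def)
  moreover have "\<forall>x. x \<le> u \<or> v \<le> x \<longrightarrow> \<theta> x = x" by (simp add: \<theta>_def)
  ultimately show ?thesis by blast
qed

section \<open>Sign matching for functions with the intermediate value property\<close>

text \<open>A polynomial composed with an order automorphism need not be a polynomial; this property
  of zeros survives the composition without any appeal to continuity.\<close>

definition ivt :: "(real \<Rightarrow> real) \<Rightarrow> bool" where
  "ivt f \<longleftrightarrow> (\<forall>a b. a < b \<longrightarrow> f a * f b < 0 \<longrightarrow> (\<exists>c. a < c \<and> c < b \<and> f c = 0))"

lemma ivt_uminus: "ivt f \<Longrightarrow> ivt (\<lambda>x. - f x)"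
  by (auto simp: ivt_def)

lemma ivt_poly: "ivt (poly p)"
  using poly_IVT unfolding ivt_def by blast

lemma ivt_order_auto:
  assumes "ivt f" "order_auto \<phi>" shows "ivt (\<lambda>x. f (\<phi> x))"
  unfolding ivt_def
proof (intro allI impI)
  fix a b :: real assume "a < b" "f (\<phi> a) * f (\<phi> b) < 0"
  then obtain c where c: "\<phi> a < c" "c < \<phi> b" "f c = 0"
    using assms order_auto_less_iff unfolding ivt_def by blast
  obtain d where "c = \<phi> d" using assms(2) by (auto simp: order_auto_def)
  then show "\<exists>c. a < c \<and> c < b \<and> f (\<phi> c) = 0"
    using c order_auto_less_iff[OF assms(2)] by auto
qed

lemma sgn_eq_no_root_between:
  assumes "ivt f" "x < y" "\<And>z. x \<le> z \<Longrightarrow> z \<le> y \<Longrightarrow> f z \<noteq> 0"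
  shows "sgn (f x) = sgn (f y)"
proof (rule ccontr)
  assume "sgn (f x) \<noteq> sgn (f y)"
  moreover have "f x \<noteq> 0" "f y \<noteq> 0" using assms by auto
  ultimately have "f x * f y < 0" by (auto simp: sgn_if mult_less_0_iff split: if_splits)
  then obtain c where "x < c" "c < y" "f c = 0" using assms unfolding ivt_def by blast
  then show False using assms(3)[of c] by auto
qed

text \<open>Each function has at most one zero on the interval. Unless the signs at the ends are
  strictly opposite, they dictate the whole pattern and the identity works; otherwise the zero of
  \<open>f\<close> is moved to that of \<open>g\<close>.\<close>

lemma match_signs_increasing:
  assumes f: "ivt f" "strict_mono_on {u..v} f" and g: "ivt g" "strict_mono_on {u..v} g"
    and uv: "u < v" and eq: "sgn (f u) = sgn (g u)" "sgn (f v) = sgn (g v)"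
  shows "\<exists>\<theta>. order_auto \<theta> \<and> (\<forall>x. x \<le> u \<or> v \<le> x \<longrightarrow> \<theta> x = x) \<and>
    (\<forall>x\<in>{u..v}. sgn (f x) = sgn (g (\<theta> x)))"
proof -
  have fm: "f x < f y" if "u \<le> x" "x < y" "y \<le> v" for x y
    using f(2) that by (auto simp: strict_mono_on_def)
  have gm: "g x < g y" if "u \<le> x" "x < y" "y \<le> v" for x y
    using g(2) that by (auto simp: strict_mono_on_def)
  consider "f u \<ge> 0" | "f v \<le> 0" | "f u < 0" "f v > 0" by linarith
  then show ?thesis
  proof cases
    case 1
    then have "g u \<ge> 0" using eq by (metis sgn_less not_le)
    then have "sgn (f x) = sgn (g x)" if "x \<in> {u..v}" for x
      using 1 fm[of u x] gm[of u x] eq that by (cases "x = u") auto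
    then show ?thesis using order_auto_id by blast
  next
    case 2
    then have "g v \<le> 0" using eq by (metis sgn_greater not_le)
    then have "sgn (f x) = sgn (g x)" if "x \<in> {u..v}" for x
      using 2 fm[of x v] gm[of x v] eq that by (cases "x = v") auto
    then show ?thesis using order_auto_id by blast
  next
    case 3
    then have g3: "g u < 0" "g v > 0" using eq by (metis sgn_less, metis sgn_greater)
    obtain a where a: "u < a" "a < v" "f a = 0" using 3 f(1) uv unfolding ivt_def by (metis mult_less_0_iff)
    obtain b where b: "u < b" "b < v" "g b = 0" using g3 g(1) uv unfolding ivt_def by (metis mult_less_0_iff)
    obtain \<theta> where \<theta>: "order_auto \<theta>" "\<theta> a = b" "\<forall>x. x \<le> u \<or> v \<le> x \<longrightarrow> \<theta> x = x"
      using order_auto_shift_point a b by blast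
    have "sgn (f x) = sgn (g (\<theta> x))" if "x \<in> {u..v}" for x
    proof -
      have r: "u \<le> \<theta> x" "\<theta> x \<le> v"
        using \<theta> that order_auto_less_iff[OF \<theta>(1), of x u] order_auto_less_iff[OF \<theta>(1), of v x]
        by (auto simp: not_less[symmetric])
      consider "x < a" | "x = a" | "a < x" by linarith
      then show ?thesis
      proof cases
        case 1
        then have "\<theta> x < b" using \<theta> order_auto_less_iff by blast
        then show ?thesis using 1 fm[of x a] gm[of "\<theta> x" b] a b r that by auto
      next
        case 2 then show ?thesis using a b \<theta> by simp
      next
        case 3
        then have "b < \<theta> x" using \<theta> order_auto_less_iff by blast
        then show ?thesis using 3 fm[of a x] gm[of b "\<theta> x"] a b r that by auto
      qed
    qed
    then show ?thesis using \<theta> by blast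
  qed
qed

definition same_direction :: "real \<Rightarrow> real \<Rightarrow> (real \<Rightarrow> real) \<Rightarrow> (real \<Rightarrow> real) \<Rightarrow> bool" where
  "same_direction u v f g \<longleftrightarrow>
     strict_mono_on {u..v} f \<and> strict_mono_on {u..v} g \<or>
     strict_mono_on {u..v} (\<lambda>x. - f x) \<and> strict_mono_on {u..v} (\<lambda>x. - g x)"

lemma match_signs_interval:
  assumes f: "ivt f" and g: "ivt g" and d: "same_direction u v f g"
    and uv: "u < v" and eq: "sgn (f u) = sgn (g u)" "sgn (f v) = sgn (g v)"
  shows "\<exists>\<theta>. order_auto \<theta> \<and> (\<forall>x. x \<le> u \<or> v \<le> x \<longrightarrow> \<theta> x = x) \<and>
    (\<forall>x\<in>{u..v}. sgn (f x) = sgn (g (\<theta> x)))"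
  using d unfolding same_direction_def
proof
  assume "strict_mono_on {u..v} f \<and> strict_mono_on {u..v} g"
  then show ?thesis using match_signs_increasing assms by blast
next
  assume "strict_mono_on {u..v} (\<lambda>x. - f x) \<and> strict_mono_on {u..v} (\<lambda>x. - g x)"
  then show ?thesis
    using match_signs_increasing[OF ivt_uminus[OF f] _ ivt_uminus[OF g]] uv eq
    by (simp add: sgn_minus)
qed

text \<open>The intervals between neighbouring points of \<open>Z\<close> are corrected separately
  and the corrections composed. Each is the identity outside its interval, so they do not
  interfere.\<close>

lemma match_signs_upto_Max:
  assumes "finite Z" "Z \<noteq> {}" and f: "ivt f" and g: "ivt g"
    and "\<And>u v. u \<in> Z \<Longrightarrow> v \<in> Z \<Longrightarrow> u < v \<Longrightarrow> {u<..<v} \<inter> Z = {} \<Longrightarrow> same_direction u v f g"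
    and "\<And>z. z \<in> Z \<Longrightarrow> sgn (f z) = sgn (g z)"
    and "\<And>x. x \<le> Min Z \<Longrightarrow> sgn (f x) = sgn (g x)"
  shows "\<exists>\<theta>. order_auto \<theta> \<and> (\<forall>z\<in>Z. \<theta> z = z) \<and> (\<forall>x\<ge>Max Z. \<theta> x = x) \<and>
    (\<forall>x\<le>Max Z. sgn (f x) = sgn (g (\<theta> x)))"
  using assms(1,2,5-)
proof (induction Z rule: finite_linorder_max_induct)
  case empty then show ?case by simp
next
  case (insert b A)
  show ?case
  proof (cases "A = {}")
    case True
    then show ?thesis using insert.prems(4) by (intro exI[of _ "\<lambda>x. x"]) (auto simp: order_auto_id)
  next
    case False
    define u where "u = Max A"
    have u: "u \<in> A" "u < b" using False insert.hyps by (auto simp: u_def)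
    have Min: "Min (insert b A) = Min A" using False insert.hyps(1) u insert.hyps(2)
      by (simp add: min_def) (meson Min_in leD)
    have Max: "Max (insert b A) = b" using insert.hyps by (intro Max_eqI) auto
    have uA: "x \<le> u" if "x \<in> A" for x using insert.hyps(1) that by (simp add: u_def)
    have "\<exists>\<theta>. order_auto \<theta> \<and> (\<forall>z\<in>A. \<theta> z = z) \<and> (\<forall>x\<ge>Max A. \<theta> x = x) \<and>
      (\<forall>x\<le>Max A. sgn (f x) = sgn (g (\<theta> x)))"
    proof (rule insert.IH)
      fix x y assume "x \<in> A" "y \<in> A" "x < y" "{x<..<y} \<inter> A = {}"
      then show "same_direction x y f g" using insert.prems(2)[of x y] insert.hyps(2) by fastforce
    qed (use False insert.prems Min in auto)
    then obtain \<theta> where \<theta>: "order_auto \<theta>" "\<forall>z\<in>A. \<theta> z = z" "\<forall>x\<ge>u. \<theta> x = x"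
      "\<forall>x\<le>u. sgn (f x) = sgn (g (\<theta> x))" unfolding u_def by blast
    have "same_direction u b f g" using insert.prems(2)[of u b] u uA by fastforce
    then obtain \<eta> where \<eta>: "order_auto \<eta>" "\<forall>x. x \<le> u \<or> b \<le> x \<longrightarrow> \<eta> x = x"
      "\<forall>x\<in>{u..b}. sgn (f x) = sgn (g (\<eta> x))"
      using match_signs_interval[OF f g] u insert.prems(3) by blast
    \<comment> \<open>Right of \<open>u\<close> the values of \<open>\<eta>\<close> stay where
      \<open>\<theta>\<close> is the identity; left of \<open>u\<close> it is \<open>\<eta>\<close>
      that is the identity.\<close>
    have \<eta>u: "\<eta> x \<ge> u" if "x \<ge> u" for x
      using order_auto_less_iff[OF \<eta>(1), of x u] \<eta>(2) that by (metis not_le order_refl)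
    show ?thesis
    proof (intro exI[of _ "\<lambda>x. \<theta> (\<eta> x)"] conjI)
      show "order_auto (\<lambda>x. \<theta> (\<eta> x))" using order_auto_comp \<theta>(1) \<eta>(1) by blast
      show "\<forall>z\<in>insert b A. \<theta> (\<eta> z) = z" using \<theta> \<eta> u uA by auto
      show "\<forall>x\<ge>Max (insert b A). \<theta> (\<eta> x) = x" using Max \<theta> \<eta> u by auto
      show "\<forall>x\<le>Max (insert b A). sgn (f x) = sgn (g (\<theta> (\<eta> x)))"
      proof (intro allI impI)
        fix x assume "x \<le> Max (insert b A)"
        then show "sgn (f x) = sgn (g (\<theta> (\<eta> x)))"
          using Max \<theta> \<eta> \<eta>u[of x] by (cases "x \<le> u") auto
      qed
    qed
  qed
qed

section \<open>Matching a polynomial whose derivative is already matched\<close>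

lemma sgn_poly_at_top: "p \<noteq> 0 \<Longrightarrow> \<exists>N. \<forall>x\<ge>N. sgn (poly p x) = sgn (lead_coeff p)" for p :: "real poly"
proof (cases "lead_coeff p > 0")
  case True
  then obtain N where "\<forall>x\<ge>N. poly p x \<ge> lead_coeff p" using poly_pinfty_gt_lc by blast
  then have "\<forall>x\<ge>N. sgn (poly p x) = sgn (lead_coeff p)" using True by (auto simp: sgn_if)
  then show ?thesis by blast
next
  case False
  assume "p \<noteq> 0"
  then have n: "lead_coeff p < 0" using False by (simp add: less_le)
  then have "lead_coeff (-p) > 0" by simp
  then obtain N where "\<forall>x\<ge>N. poly (-p) x \<ge> lead_coeff (-p)" using poly_pinfty_gt_lc by blast
  then have "\<forall>x\<ge>N. sgn (poly p x) = sgn (lead_coeff p)" using n by (force simp: sgn_if)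
  then show ?thesis by blast
qed

lemma sgn_poly_at_bot:
  fixes p :: "real poly" assumes "p \<noteq> 0"
  shows "\<exists>N. \<forall>x\<le>N. sgn (poly p x) = (-1) ^ degree p * sgn (lead_coeff p)"
proof -
  define q where "q = pcompose p [:0, -1:]"
  have q: "poly q x = poly p (- x)" for x by (simp add: q_def poly_pcompose)
  have lc: "lead_coeff q = lead_coeff p * (-1) ^ degree p"
    by (simp add: q_def lead_coeff_comp)
  then have "q \<noteq> 0" using assms by auto
  then obtain N where N: "\<forall>x\<ge>N. sgn (poly q x) = sgn (lead_coeff q)" using sgn_poly_at_top by blast
  have "sgn (poly p x) = (-1) ^ degree p * sgn (lead_coeff p)" if "x \<le> - N" for x
  proof -
    have "sgn (poly q (- x)) = sgn (lead_coeff q)" using N that by simp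
    then show ?thesis unfolding q lc by (cases "even (degree p)") (simp_all add: sgn_mult)
  qed
  then show ?thesis by blast
qed

lemma poly_strict_mono_on:
  fixes p :: "real poly"
  assumes "\<And>x. u < x \<Longrightarrow> x < v \<Longrightarrow> poly (pderiv p) x > 0"
  shows "strict_mono_on {u..v} (poly p)"
proof (rule strict_mono_onI)
  fix r s assume "r \<in> {u..v}" "s \<in> {u..v}" "r < s"
  then show "poly p r < poly p s"
    using assms poly_DERIV[of p]
    by (intro DERIV_pos_imp_increasing_open[of r s "poly p"])
      (fastforce intro: exI[of _ "poly (pderiv p) _"] intro!: continuous_intros)+
qed

text \<open>The function to be matched with \<open>p\<close> is \<open>poly q\<close> after
  \<open>\<phi>\<close>. Between neighbouring points of \<open>Z\<close> the derivative of
  \<open>p\<close> has no zero, so both functions are monotone there, in the same direction by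
  \<open>sd\<close>. That \<open>\<theta>\<close> fixes \<open>Z\<close> protects the matches of
  other polynomials with roots in \<open>Z\<close>.\<close>

lemma match_signs_poly:
  fixes p q :: "real poly"
  assumes \<phi>: "order_auto \<phi>" and Z: "finite Z"
    and deg: "degree p = degree q" "sgn (lead_coeff p) = sgn (lead_coeff q)" "p \<noteq> 0"
    and sZ: "\<And>z. z \<in> Z \<Longrightarrow> sgn (poly p z) = sgn (poly q (\<phi> z))"
    and dZ: "\<And>x. poly (pderiv p) x = 0 \<Longrightarrow> x \<in> Z"
    and sd: "\<And>x. sgn (poly (pderiv p) x) = sgn (poly (pderiv q) (\<phi> x))"
  shows "\<exists>\<theta>. order_auto \<theta> \<and> (\<forall>z\<in>Z. \<theta> z = z) \<and> (\<forall>x. sgn (poly p x) = sgn (poly q (\<phi> (\<theta> x))))"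
proof -
  have q0: "q \<noteq> 0" using deg by (metis leading_coeff_0_iff sgn_0_0)
  obtain M1 where M1: "\<forall>x\<ge>M1. sgn (poly p x) = sgn (lead_coeff p)" using sgn_poly_at_top deg by blast
  obtain M2 where M2: "\<forall>x\<ge>M2. sgn (poly q x) = sgn (lead_coeff q)" using sgn_poly_at_top q0 by blast
  obtain N1 where N1: "\<forall>x\<le>N1. sgn (poly p x) = (-1) ^ degree p * sgn (lead_coeff p)"
    using sgn_poly_at_bot deg by blast
  obtain N2 where N2: "\<forall>x\<le>N2. sgn (poly q x) = (-1) ^ degree q * sgn (lead_coeff q)"
    using sgn_poly_at_bot q0 by blast
  \<comment> \<open>\<open>M2\<close> and \<open>N2\<close> are bounds for the argument of
    \<open>q\<close>, which is \<open>\<phi> x\<close>, so they are pulled back through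
    \<open>\<phi>\<close>.\<close>
  obtain M3 where M3: "\<phi> M3 = M2" using \<phi> by (metis order_auto_def surj_def)
  obtain N3 where N3: "\<phi> N3 = N2" using \<phi> by (metis order_auto_def surj_def)
  define M N where "M = max M1 M3" and "N = min N1 N3"
  have M: "sgn (poly p x) = sgn (poly q (\<phi> x))" if "x \<ge> M" for x
    using M1 M2 M3 that deg order_auto_less_iff[OF \<phi>, of x M3] by (auto simp: M_def not_less[symmetric])
  have N: "sgn (poly p x) = sgn (poly q (\<phi> x))" if "x \<le> N" for x
    using N1 N2 N3 that deg order_auto_less_iff[OF \<phi>, of N3 x] by (auto simp: N_def not_less[symmetric])
  \<comment> \<open>Beyond \<open>N\<close> and \<open>M\<close> the signs agree already, because
    degrees and leading signs coincide. With these two ends added only bounded intervals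
    remain.\<close>
  define Y where "Y = insert M (insert N Z)"
  have Y: "finite Y" "Y \<noteq> {}" using Z by (auto simp: Y_def)
  have "Min Y \<le> N" "Max Y \<ge> M" using Y(1) by (auto simp: Y_def intro!: Min_le Max_ge simp del: Min_insert Max_insert)
  have "\<exists>\<theta>. order_auto \<theta> \<and> (\<forall>z\<in>Y. \<theta> z = z) \<and> (\<forall>x\<ge>Max Y. \<theta> x = x) \<and>
    (\<forall>x\<le>Max Y. sgn (poly p x) = sgn (poly q (\<phi> (\<theta> x))))"
  proof (rule match_signs_upto_Max[OF Y ivt_poly ivt_order_auto[OF ivt_poly \<phi>]])
    fix u v assume uv: "u < v" "{u<..<v} \<inter> Y = {}"
    have nz: "poly (pderiv p) x \<noteq> 0" if "u < x" "x < v" for x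
      using uv that dZ[of x] by (auto simp: Y_def)
    have sg: "sgn (poly (pderiv p) x) = sgn (poly (pderiv p) y)" if "u < x" "x < v" "u < y" "y < v" for x y
    proof -
      consider "x < y" | "x = y" | "y < x" by linarith
      then show ?thesis
        by cases (use sgn_eq_no_root_between[OF ivt_poly, of x y] sgn_eq_no_root_between[OF ivt_poly, of y x] nz that in force)+
    qed
    define m where "m = (u + v) / 2"
    have m: "u < m" "m < v" using uv by (auto simp: m_def)
    have sub: "\<exists>y. x = \<phi> y \<and> u < y \<and> y < v" if "\<phi> u < x" "x < \<phi> v" for x
    proof -
      obtain y where "x = \<phi> y" using \<phi> by (metis order_auto_def surj_def)
      then show ?thesis using that order_auto_less_iff[OF \<phi>] by auto
    qed
    \<comment> \<open>\<open>\<phi>\<close> need not be differentiable, so monotonicity is obtained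
      between \<open>\<phi> u\<close> and \<open>\<phi> v\<close> and then pulled back.\<close>
    have comp: "strict_mono_on {u..v} (\<lambda>x. poly r (\<phi> x))" if "strict_mono_on {\<phi> u..\<phi> v} (poly r)" for r
      using that order_auto_less_iff[OF \<phi>] unfolding strict_mono_on_def
      by (auto simp: not_less[symmetric])
    show "same_direction u v (poly p) (\<lambda>x. poly q (\<phi> x))"
    proof (cases "poly (pderiv p) m > 0")
      case True
      have 1: "poly (pderiv p) x > 0" if "u < x" "x < v" for x
        using sg[OF that m] True by (simp add: sgn_if split: if_splits)
      have 2: "poly (pderiv q) x > 0" if "\<phi> u < x" "x < \<phi> v" for x
        using sub[OF that] sd 1 by (metis sgn_greater)
      show ?thesis unfolding same_direction_def
        using poly_strict_mono_on[OF 1] comp[OF poly_strict_mono_on[OF 2]] by blast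
    next
      case False
      then have neg: "poly (pderiv p) m < 0" using nz[OF m] by simp
      have 1: "poly (pderiv p) x < 0" if "u < x" "x < v" for x
        using sg[OF that m] neg by (simp add: sgn_if split: if_splits)
      have 2: "poly (pderiv q) x < 0" if "\<phi> u < x" "x < \<phi> v" for x
        using sub[OF that] sd 1 by (metis sgn_less)
      show ?thesis unfolding same_direction_def
        using poly_strict_mono_on[of u v "-p"] comp[of "- q"] poly_strict_mono_on[of "\<phi> u" "\<phi> v" "-q"] 1 2
        by (simp add: pderiv_minus strict_mono_on_def)
    qed
  next
    fix z assume "z \<in> Y" then show "sgn (poly p z) = sgn (poly q (\<phi> z))"
      using sZ M N by (auto simp: Y_def)
  next
    fix x assume "x \<le> Min Y" then show "sgn (poly p x) = sgn (poly q (\<phi> x))"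
      using N \<open>Min Y \<le> N\<close> by auto
  qed
  then obtain \<theta> where \<theta>: "order_auto \<theta>" "\<forall>z\<in>Y. \<theta> z = z" "\<forall>x\<ge>Max Y. \<theta> x = x"
    "\<forall>x\<le>Max Y. sgn (poly p x) = sgn (poly q (\<phi> (\<theta> x)))" by blast
  have "sgn (poly p x) = sgn (poly q (\<phi> (\<theta> x)))" for x
    using \<theta> M[of x] \<open>Max Y \<ge> M\<close> by (cases "x \<le> Max Y") auto
  then show ?thesis using \<theta> by (intro exI[of _ \<theta>]) (auto simp: Y_def)
qed

text \<open>An order automorphism cannot carry a point across a fixed point, so no root separates
  \<open>x\<close> from \<open>\<theta> x\<close>.\<close>

lemma sgn_fixing_roots:
  assumes "ivt f" "order_auto \<theta>" "\<And>z. f z = 0 \<Longrightarrow> \<theta> z = z"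
  shows "sgn (f (\<theta> x)) = sgn (f x)"
proof -
  have *: "\<theta> z \<noteq> z" if "x \<le> z \<and> z \<le> \<theta> x \<or> \<theta> x \<le> z \<and> z \<le> x" "\<theta> x \<noteq> x" for z
    using that order_auto_less_iff[OF assms(2), of x z] order_auto_less_iff[OF assms(2), of z x]
    by (cases "x = z") auto
  consider "x < \<theta> x" | "x = \<theta> x" | "\<theta> x < x" by linarith
  then show ?thesis
    by cases (use sgn_eq_no_root_between[OF assms(1), of x "\<theta> x"]
      sgn_eq_no_root_between[OF assms(1), of "\<theta> x" x] assms(3) * in force)+
qed

section \<open>Polynomials with coefficients depending on parameters\<close>

text \<open>Integer polynomials in the coordinates, taken as functions so that changing the
  environment needs no syntax. Integrality matters: on constant environments they become univariate
  integer polynomials, whose roots are the algebraic numbers.\<close>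

inductive int_poly_fun :: "(('i \<Rightarrow> real) \<Rightarrow> real) \<Rightarrow> bool" where
  int_poly_fun_coord: "int_poly_fun (\<lambda>e. e i)"
| int_poly_fun_one: "int_poly_fun (\<lambda>e. 1)"
| int_poly_fun_diff: "int_poly_fun f \<Longrightarrow> int_poly_fun g \<Longrightarrow> int_poly_fun (\<lambda>e. f e - g e)"
| int_poly_fun_mult: "int_poly_fun f \<Longrightarrow> int_poly_fun g \<Longrightarrow> int_poly_fun (\<lambda>e. f e * g e)"

lemma int_poly_fun_zero: "int_poly_fun (\<lambda>e. 0)"
  using int_poly_fun_diff[OF int_poly_fun_one int_poly_fun_one] by simp

lemma int_poly_fun_add:
  assumes "int_poly_fun f" "int_poly_fun g" shows "int_poly_fun (\<lambda>e. f e + g e)"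
  using int_poly_fun_diff[OF assms(1) int_poly_fun_diff[OF int_poly_fun_zero assms(2)]] by simp

lemma int_poly_fun_of_nat: "int_poly_fun (\<lambda>e. of_nat n)"
  by (induction n) (auto intro: int_poly_fun_zero int_poly_fun_one int_poly_fun_add)

lemma int_poly_fun_of_int: "int_poly_fun (\<lambda>e. of_int k)"
proof (cases "k \<ge> 0")
  case True
  then show ?thesis using int_poly_fun_of_nat[of "nat k"] by simp
next
  case False
  then show ?thesis
    using int_poly_fun_diff[OF int_poly_fun_zero int_poly_fun_of_nat[of "nat (- k)"]] by simp
qed

definition same_signs :: "('e \<Rightarrow> real) set \<Rightarrow> 'e \<Rightarrow> 'e \<Rightarrow> bool" where
  "same_signs Q e e' \<longleftrightarrow> (\<forall>q\<in>Q. sgn (q e) = sgn (q e'))"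

lemma same_signs_sym: "same_signs Q e e' \<Longrightarrow> same_signs Q e' e"
  by (simp add: same_signs_def)

lemma same_signs_Un: "same_signs (Q \<union> R) e e' \<longleftrightarrow> same_signs Q e e' \<and> same_signs R e e'"
  by (auto simp: same_signs_def)

lemma same_signsD: "same_signs Q e e' \<Longrightarrow> q \<in> Q \<Longrightarrow> sgn (q e) = sgn (q e')"
  by (simp add: same_signs_def)

text \<open>Coefficient lists start with the constant coefficient; the coefficients are functions of
  the parameters, so the formal leading coefficient \<open>last cs\<close> may vanish at particular ones.\<close>

definition poly_at :: "'e \<Rightarrow> ('e \<Rightarrow> real) list \<Rightarrow> real poly" where
  "poly_at e cs = Poly (map (\<lambda>c. c e) cs)"

lemma coeff_poly_at: "coeff (poly_at e cs) i = (if i < length cs then (cs ! i) e else 0)"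
  by (simp add: poly_at_def nth_default_def)

lemma poly_at_eqI:
  "(\<And>i. (if i < length cs then (cs ! i) e else 0) = coeff p i) \<Longrightarrow> poly_at e cs = p"
  by (rule poly_eqI) (simp add: coeff_poly_at)

lemma poly_at_butlast:
  assumes "cs \<noteq> []" "last cs e = 0" shows "poly_at e (butlast cs) = poly_at e cs"
proof (rule poly_at_eqI)
  fix i
  show "(if i < length (butlast cs) then (butlast cs ! i) e else 0) = coeff (poly_at e cs) i"
    using assms by (auto simp: coeff_poly_at nth_butlast last_conv_nth)
      (metis Suc_pred length_greater_0_conv less_antisym)
qed

lemma degree_poly_at:
  assumes "cs \<noteq> []" "last cs e \<noteq> 0"
  shows "degree (poly_at e cs) = length cs - 1" "lead_coeff (poly_at e cs) = last cs e"
proof -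
  show *: "degree (poly_at e cs) = length cs - 1"
  proof (rule antisym)
    show "degree (poly_at e cs) \<le> length cs - 1"
      by (rule degree_le) (auto simp: coeff_poly_at)
    show "length cs - 1 \<le> degree (poly_at e cs)"
      using assms by (intro le_degree) (auto simp: coeff_poly_at last_conv_nth)
  qed
  show "lead_coeff (poly_at e cs) = last cs e"
    using assms by (simp add: * coeff_poly_at last_conv_nth)
qed

lemma poly_at_take:
  assumes "\<And>i. j \<le> i \<Longrightarrow> i < length cs \<Longrightarrow> (cs ! i) e = 0"
  shows "poly_at e (take j cs) = poly_at e cs"
  by (rule poly_at_eqI) (use assms in \<open>auto simp: coeff_poly_at\<close>)

text \<open>Division needs a nonvanishing leading coefficient, so the list is cut at the true degree
  at \<open>e\<close>. The cut depends only on which coefficients vanish, so parameters with equal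
  coefficient signs share it.\<close>

lemma exists_degree_truncation:
  assumes "poly_at e cs \<noteq> 0"
  shows "\<exists>j \<le> length cs. take j cs \<noteq> [] \<and> last (take j cs) e \<noteq> 0 \<and>
           (\<forall>i\<ge>j. i < length cs \<longrightarrow> (cs ! i) e = 0)"
proof -
  define d where "d = degree (poly_at e cs)"
  have nz: "coeff (poly_at e cs) d \<noteq> 0" using assms by (simp add: d_def)
  then have d: "d < length cs" "(cs ! d) e \<noteq> 0" by (auto simp: coeff_poly_at split: if_splits)
  have "(cs ! i) e = 0" if "i \<ge> Suc d" "i < length cs" for i
    using that coeff_eq_0[of "poly_at e cs" i] by (simp add: d_def coeff_poly_at)
  moreover have "last (take (Suc d) cs) = cs ! d" using d by (simp add: take_Suc_conv_app_nth)
  ultimately show ?thesis using d by (intro exI[of _ "Suc d"]) auto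
qed

definition deriv_list :: "('e \<Rightarrow> real) list \<Rightarrow> ('e \<Rightarrow> real) list" where
  "deriv_list cs = map (\<lambda>i e. of_nat (Suc i) * (cs ! Suc i) e) [0..<length cs - 1]"

lemma poly_at_deriv_list: "poly_at e (deriv_list cs) = pderiv (poly_at e cs)"
  by (rule poly_at_eqI) (auto simp: deriv_list_def coeff_pderiv coeff_poly_at)

text \<open>One step of pseudo-division of \<open>p\<close> by \<open>q\<close>: the leading terms cancel, and at a root of
  \<open>q\<close> the value is that of \<open>p\<close> times the leading coefficient of \<open>q\<close>. Full remainders are
  not needed.\<close>

definition reduce_list :: "('e \<Rightarrow> real) list \<Rightarrow> ('e \<Rightarrow> real) list \<Rightarrow> ('e \<Rightarrow> real) list" where
  "reduce_list p q = map (\<lambda>i e. last q e * (p ! i) e -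
     last p e * (if i < length p - length q then 0 else (q ! (i - (length p - length q))) e)) [0..<length p - 1]"

lemma poly_at_reduce_list:
  assumes "q \<noteq> []" "length q \<le> length p"
  shows "poly_at e (reduce_list p q) = smult (last q e) (poly_at e p) -
    smult (last p e) (monom 1 (length p - length q) * poly_at e q)"
proof (rule poly_at_eqI)
  fix i
  have p: "p \<noteq> []" using assms by auto
  consider "i < length p - 1" | "i = length p - 1" | "i \<ge> length p" by linarith
  then show "(if i < length (reduce_list p q) then (reduce_list p q ! i) e else 0) = coeff (smult (last q e) (poly_at e p) -
    smult (last p e) (monom 1 (length p - length q) * poly_at e q)) i"
  proof cases
    case 1
    then show ?thesis using assms by (auto simp: reduce_list_def coeff_poly_at coeff_monom_mult)
  next
    \<comment> \<open>At the top index both products equal \<open>last q e * last p e\<close> and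
      cancel; this is why the list is shorter by one.\<close>
    case 2
    have "length p - Suc 0 - (length p - length q) = length q - Suc 0" "\<not> length p - Suc 0 < length p - length q"
      using assms p by (auto simp: Suc_le_eq neq_Nil_conv)
    then show ?thesis using 2 assms p
      by (auto simp: reduce_list_def coeff_poly_at coeff_monom_mult last_conv_nth)
  next
    case 3
    then show ?thesis using assms p by (auto simp: reduce_list_def coeff_poly_at coeff_monom_mult)
  qed
qed

lemma poly_reduce_list_root:
  assumes "q \<noteq> []" "length q \<le> length p" "poly (poly_at e q) z = 0"
  shows "poly (poly_at e (reduce_list p q)) z = last q e * poly (poly_at e p) z"
  using assms by (simp add: poly_at_reduce_list)

definition int_poly_list :: "(('i \<Rightarrow> real) \<Rightarrow> real) list \<Rightarrow> bool" where
  "int_poly_list cs \<longleftrightarrow> (\<forall>c\<in>set cs. int_poly_fun c)"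

lemma int_poly_list_butlast: "int_poly_list cs \<Longrightarrow> int_poly_list (butlast cs)"
  by (auto simp: int_poly_list_def dest: in_set_butlastD)

lemma int_poly_list_take: "int_poly_list cs \<Longrightarrow> int_poly_list (take j cs)"
  by (auto simp: int_poly_list_def dest: in_set_takeD)

lemma int_poly_list_deriv: "int_poly_list cs \<Longrightarrow> int_poly_list (deriv_list cs)"
  by (auto simp: int_poly_list_def deriv_list_def simp del: of_nat_Suc intro!: int_poly_fun_mult int_poly_fun_of_nat)

lemma int_poly_list_reduce:
  assumes "int_poly_list p" "int_poly_list q" "q \<noteq> []" "length q \<le> length p"
  shows "int_poly_list (reduce_list p q)"
  unfolding int_poly_list_def
proof
  fix c assume "c \<in> set (reduce_list p q)"
  then obtain i where i: "i < length p - 1" and c: "c = (\<lambda>e. last q e * (p ! i) e -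
     last p e * (if i < length p - length q then 0 else (q ! (i - (length p - length q))) e))"
    unfolding reduce_list_def by auto
  have "p \<noteq> []" using i by auto
  have "int_poly_fun (\<lambda>e. if i < length p - length q then 0 else (q ! (i - (length p - length q))) e)"
    using assms i by (cases "i < length p - length q") (auto simp: int_poly_list_def int_poly_fun_zero)
  moreover have "int_poly_fun (last q)" "int_poly_fun (last p)" "int_poly_fun (p ! i)"
    using assms last_in_set[of p] last_in_set[of q] nth_mem[of i p] i \<open>p \<noteq> []\<close>
    by (auto simp: int_poly_list_def simp del: nth_mem)
  ultimately show "int_poly_fun c" unfolding c
    by (intro int_poly_fun_diff int_poly_fun_mult)
qed

section \<open>Finite families with parameters, matched by one automorphism\<close>

text \<open>One \<open>\<phi>\<close> serves the whole family, because a witness for a condition on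
  several polynomials must be carried over with all its signs at once.\<close>

definition matches :: "('e \<Rightarrow> real) list set \<Rightarrow> 'e \<Rightarrow> 'e \<Rightarrow> bool" where
  "matches F e e' \<longleftrightarrow> (\<exists>\<phi>. order_auto \<phi> \<and>
     (\<forall>cs\<in>F. \<forall>x. sgn (poly (poly_at e cs) x) = sgn (poly (poly_at e' cs) (\<phi> x))))"

definition sign_controlled :: "(('i \<Rightarrow> real) \<Rightarrow> real) list set \<Rightarrow> bool" where
  "sign_controlled F \<longleftrightarrow> (\<exists>Q. finite Q \<and> (\<forall>q\<in>Q. int_poly_fun q) \<and>
     (\<forall>e e'. same_signs Q e e' \<longrightarrow> matches F e e'))"

definition coeffs_of :: "('e \<Rightarrow> real) list set \<Rightarrow> ('e \<Rightarrow> real) set" where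
  "coeffs_of F = \<Union> (set ` F)"

text \<open>The signs of \<open>p\<close> at the roots of the other polynomials are known from the reductions of \<open>p\<close>
  modulo their truncations; between these roots \<open>p\<close> is strictly monotone, because the roots of its
  derivative are among them.\<close>

lemma matches_step:
  fixes p :: "('e \<Rightarrow> real) list"
  assumes F: "finite G" "\<And>q. q \<in> G \<Longrightarrow> length q \<le> length p" and len: "length p \<ge> 2"
    and H: "insert (deriv_list p) G \<subseteq> H" "butlast p \<in> H"
      "\<And>q j. q \<in> insert (deriv_list p) G \<Longrightarrow> take j q \<noteq> [] \<Longrightarrow> reduce_list p (take j q) \<in> H"
    and m: "matches H e e'" and s: "same_signs (coeffs_of (insert p (insert (deriv_list p) G))) e e'"
  shows "matches (insert p G) e e'"
proof -
  obtain \<phi> where \<phi>: "order_auto \<phi>"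
    and mH: "\<And>cs x. cs \<in> H \<Longrightarrow> sgn (poly (poly_at e cs) x) = sgn (poly (poly_at e' cs) (\<phi> x))"
    using m unfolding matches_def by blast
  have p: "p \<noteq> []" using len by auto
  have sc: "sgn (c e) = sgn (c e')" if "c \<in> set q" "q \<in> insert p (insert (deriv_list p) G)" for c q
    using s that by (auto simp: same_signs_def coeffs_of_def)
  have lastp: "sgn (last p e) = sgn (last p e')" using sc[of "last p" p] p by simp
  show ?thesis
  proof (cases "last p e = 0")
    \<comment> \<open>The formal leading term is absent at both parameters, so \<open>p\<close> can
      be replaced by the shorter \<open>butlast p\<close>.\<close>
    case True
    then have "last p e' = 0" using lastp by (metis sgn_0_0)
    then have "poly_at e (butlast p) = poly_at e p" "poly_at e' (butlast p) = poly_at e' p"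
      using poly_at_butlast[OF p] True by simp_all
    then have "sgn (poly (poly_at e cs) x) = sgn (poly (poly_at e' cs) (\<phi> x))" if "cs \<in> insert p G" for cs x
      using mH[of cs x] mH[of "butlast p" x] H(1,2) that by auto
    then show ?thesis using \<phi> unfolding matches_def by blast
  next
    case False
    then have nz': "last p e' \<noteq> 0" using lastp by (metis sgn_0_0)
    define P P' where "P = poly_at e p" and "P' = poly_at e' p"
    have deg: "degree P = degree P'" "lead_coeff P = last p e" "lead_coeff P' = last p e'" "degree P \<noteq> 0"
      using degree_poly_at[OF p False] degree_poly_at[OF p nz'] len by (auto simp: P_def P'_def)
    have d0: "pderiv P \<noteq> 0" using deg(4) by (simp add: pderiv_eq_0_iff)
    define G' where "G' = insert (deriv_list p) G"
    \<comment> \<open>Polynomials vanishing identically at \<open>e\<close> are left out to keep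
      \<open>Z\<close> finite; their sign is zero everywhere, so moving the argument does them no
      harm.\<close>
    define Z where "Z = (\<Union>q\<in>{q\<in>G'. poly_at e q \<noteq> 0}. {x. poly (poly_at e q) x = 0})"
    have finZ: "finite Z" using F by (auto simp: Z_def G'_def poly_roots_finite)
    have lenG': "length q \<le> length p" if "q \<in> G'" for q
      using F that by (auto simp: G'_def deriv_list_def)
    have sZ: "sgn (poly P z) = sgn (poly P' (\<phi> z))" if "z \<in> Z" for z
    proof -
      obtain q where q: "q \<in> G'" "poly_at e q \<noteq> 0" "poly (poly_at e q) z = 0"
        using \<open>z \<in> Z\<close> unfolding Z_def by blast
      obtain j where j: "j \<le> length q" "take j q \<noteq> []" "last (take j q) e \<noteq> 0"
        "\<forall>i\<ge>j. i < length q \<longrightarrow> (q ! i) e = 0"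
        using exists_degree_truncation[OF q(2)] by blast
      define t where "t = take j q"
      have j': "(q ! i) e' = 0" if "i \<ge> j" "i < length q" for i
        using j(4) that sc[of "q ! i" q] q(1) by (auto simp: G'_def sgn_0_0)
      have eq: "poly_at e t = poly_at e q" "poly_at e' t = poly_at e' q"
        unfolding t_def using poly_at_take[of j q] j(4) j' by simp_all
      have qH: "q \<in> H" using q(1) H(1) by (auto simp: G'_def)
      have root: "poly (poly_at e t) z = 0" "poly (poly_at e' t) (\<phi> z) = 0"
        using q(3) mH[OF qH, of z] by (simp_all add: eq sgn_0_0)
      have lt: "length t \<le> length p" using lenG'[OF q(1)] by (simp add: t_def)
      have last: "sgn (last t e) = sgn (last t e')"
        using sc[of "last t" q] q(1) j(2) in_set_takeD[of "last t" j q] by (auto simp: t_def G'_def)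
      \<comment> \<open>At a root of \<open>t\<close> the reduction has the sign of \<open>p\<close>
        times that of the leading coefficient of \<open>t\<close>. The latter is nonzero and has the
        same sign at both parameters, so it can be cancelled.\<close>
      have "reduce_list p t \<in> H" using H(3) q(1) j(2) by (simp add: t_def G'_def)
      from mH[OF this, of z] have "sgn (last t e) * sgn (poly P z) = sgn (last t e') * sgn (poly P' (\<phi> z))"
        using poly_reduce_list_root[OF _ lt root(1)] poly_reduce_list_root[OF _ lt root(2)] j(2)
        by (simp add: t_def P_def P'_def sgn_mult)
      then show ?thesis using last j(3) by (auto simp: t_def sgn_0_0)
    qed
    have dZ: "x \<in> Z" if "poly (pderiv P) x = 0" for x
      using that d0 by (auto simp: Z_def G'_def P_def poly_at_deriv_list[symmetric])
    have sd: "sgn (poly (pderiv P) x) = sgn (poly (pderiv P') (\<phi> x))" for x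
      using mH[of "deriv_list p" x] H(1) by (simp add: P_def P'_def poly_at_deriv_list)
    have "P \<noteq> 0" using deg(4) by auto
    then obtain \<theta> where \<theta>: "order_auto \<theta>" "\<forall>z\<in>Z. \<theta> z = z" "\<forall>x. sgn (poly P x) = sgn (poly P' (\<phi> (\<theta> x)))"
      using match_signs_poly[OF \<phi> finZ deg(1) _ _ sZ dZ sd] deg lastp by auto
    have "sgn (poly (poly_at e q) x) = sgn (poly (poly_at e' q) (\<phi> (\<theta> x)))" if "q \<in> G" for q x
    proof -
      have *: "sgn (poly (poly_at e q) (\<theta> x)) = sgn (poly (poly_at e' q) (\<phi> (\<theta> x)))"
        using mH that H(1) by blast
      have "sgn (poly (poly_at e q) (\<theta> x)) = sgn (poly (poly_at e q) x)"
      proof (cases "poly_at e q = 0")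
        case False
        then show ?thesis using \<theta> that by (intro sgn_fixing_roots ivt_poly) (auto simp: Z_def G'_def)
      qed simp
      then show ?thesis using * by simp
    qed
    then show ?thesis unfolding matches_def
      by (intro exI[of _ "\<lambda>x. \<phi> (\<theta> x)"]) (auto simp: \<theta>(3) P_def[symmetric] P'_def[symmetric] order_auto_comp \<phi> \<theta>(1))
  qed
qed

lemma sign_controlled_const:
  assumes "finite F" "\<And>cs. cs \<in> F \<Longrightarrow> int_poly_list cs \<and> length cs \<le> 1"
  shows "sign_controlled F"
  unfolding sign_controlled_def
proof (intro exI[of _ "coeffs_of F"] conjI allI impI)
  show "finite (coeffs_of F)" using assms by (auto simp: coeffs_of_def)
  show "\<forall>q\<in>coeffs_of F. int_poly_fun q" using assms by (auto simp: coeffs_of_def int_poly_list_def)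
  fix e e' assume s: "same_signs (coeffs_of F) e e'"
  have "sgn (poly (poly_at e cs) x) = sgn (poly (poly_at e' cs) x)" if "cs \<in> F" for cs x
  proof (cases cs)
    case (Cons c ds)
    then have "cs = [c]" using assms(2)[OF that] by simp
    moreover have "sgn (c e) = sgn (c e')" using s that \<open>cs = [c]\<close>
      by (auto simp: same_signs_def coeffs_of_def)
    ultimately show ?thesis by (simp add: poly_at_def)
  qed (simp add: poly_at_def)
  then show "matches F e e'" unfolding matches_def using order_auto_id by blast
qed

text \<open>\<open>p\<close> is traded for its derivative, \<open>butlast p\<close> and its
  reductions, all shorter than \<open>p\<close>. Shorter lists may multiply, but those of maximal
  length become one fewer; hence \<open>IH\<close> prescribes only which lists attain that
  length.\<close>

lemma sign_controlled_step:
  fixes p :: "(('i \<Rightarrow> real) \<Rightarrow> real) list"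
  assumes F: "finite G" "\<And>q. q \<in> insert p G \<Longrightarrow> int_poly_list q \<and> length q \<le> length p"
    and len: "length p \<ge> 2" "p \<notin> G"
    and IH: "\<And>H. finite H \<Longrightarrow> (\<And>q. q \<in> H \<Longrightarrow> int_poly_list q \<and> length q \<le> length p) \<Longrightarrow>
      {q \<in> H. length q = length p} = {q \<in> G. length q = length p} \<Longrightarrow> sign_controlled H"
  shows "sign_controlled (insert p G)"
proof -
  define G' where "G' = insert (deriv_list p) G"
  \<comment> \<open>Which truncation has a nonvanishing leading coefficient depends on the
    parameters, so all of them are used.\<close>
  define T where "T = {t. \<exists>q\<in>G'. \<exists>j\<le>length q. t = take j q \<and> t \<noteq> []}"
  define H where "H = insert (butlast p) (G' \<union> reduce_list p ` T)"
  have G': "finite G'" "\<And>q. q \<in> G' \<Longrightarrow> int_poly_list q \<and> length q \<le> length p"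
    using F int_poly_list_deriv[of p] by (auto simp: G'_def deriv_list_def)
  have "T \<subseteq> (\<Union>q\<in>G'. (\<lambda>j. take j q) ` {..length q})" by (auto simp: T_def)
  then have "finite T" by (rule finite_subset) (use G'(1) in auto)
  then have finH: "finite H" using G' by (simp add: H_def)
  have Tp: "int_poly_list t \<and> t \<noteq> [] \<and> length t \<le> length p" if "t \<in> T" for t
    using that G'(2) int_poly_list_take by (force simp: T_def)
  have redlen: "length (reduce_list p t) = length p - 1" for t by (simp add: reduce_list_def)
  have "sign_controlled H"
  proof (rule IH[OF finH])
    fix q assume "q \<in> H"
    then show "int_poly_list q \<and> length q \<le> length p"
      using G'(2) Tp F(2)[of p] int_poly_list_butlast[of p] int_poly_list_reduce[of p]
      by (auto simp: H_def redlen)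
  next
    show "{q \<in> H. length q = length p} = {q \<in> G. length q = length p}"
      using len by (auto simp: H_def G'_def redlen deriv_list_def)
  qed
  then obtain Q where Q: "finite Q" "\<forall>q\<in>Q. int_poly_fun q" "\<forall>e e'. same_signs Q e e' \<longrightarrow> matches H e e'"
    unfolding sign_controlled_def by blast
  \<comment> \<open>The coefficient signs decide whether \<open>last p\<close> vanishes and where
    the other lists are to be cut.\<close>
  define R where "R = coeffs_of (insert p G')"
  have R: "finite R" "\<forall>q\<in>R. int_poly_fun q"
    using G' F(2)[of p] by (auto simp: R_def coeffs_of_def int_poly_list_def)
  have "matches (insert p G) e e'" if "same_signs (Q \<union> R) e e'" for e e'
  proof (rule matches_step[OF F(1) _ len(1)])
    show "insert (deriv_list p) G \<subseteq> H" "butlast p \<in> H" by (auto simp: H_def G'_def)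
    show "reduce_list p (take j q) \<in> H" if "q \<in> insert (deriv_list p) G" "take j q \<noteq> []" for q j
    proof -
      have "take j q = take (min j (length q)) q" by (simp add: min_def)
      then have "take j q \<in> T" using that unfolding T_def G'_def mem_Collect_eq by (metis min.cobounded2)
      then show ?thesis by (simp add: H_def)
    qed
    show "matches H e e'" using that Q by (simp add: same_signs_Un)
    show "same_signs (coeffs_of (insert p (insert (deriv_list p) G))) e e'"
      using that by (simp add: same_signs_Un R_def G'_def)
  qed (use F in auto)
  then show ?thesis unfolding sign_controlled_def using Q R
    by (intro exI[of _ "Q \<union> R"]) auto
qed

text \<open>The induction is lexicographic: on a bound for the lengths and, inside, on the number of
  lists attaining it. It starts from lists of length at most one, which are constant in
  \<open>x\<close>.\<close>

theorem sign_controlled: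
  assumes "finite F" "\<And>cs. cs \<in> F \<Longrightarrow> int_poly_list cs"
  shows "sign_controlled F"
proof -
  have "sign_controlled F" if "finite F" "\<And>cs. cs \<in> F \<Longrightarrow> int_poly_list cs \<and> length cs \<le> Suc n" for F :: "(('a \<Rightarrow> real) \<Rightarrow> real) list set" and n
    using that
  proof (induction n arbitrary: F)
    case 0
    then show ?case using sign_controlled_const by auto
  next
    case (Suc n)
    note outer = Suc.IH
    define k where "k = card {q \<in> F. length q = Suc (Suc n)}"
    then show ?case using Suc.prems
    proof (induction k arbitrary: F)
      case 0
      then have "{q \<in> F. length q = Suc (Suc n)} = {}" by simp
      then show ?case using outer[OF 0(2)] 0(3) by (metis (mono_tags, lifting) empty_Collect_eq le_SucE)
    next
      case (Suc k)
      then obtain p where p: "p \<in> F" "length p = Suc (Suc n)"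
        by (metis (mono_tags, lifting) card.empty empty_Collect_eq nat.distinct(1))
      define G where "G = F - {p}"
      have F: "F = insert p G" "p \<notin> G" "finite G" using p Suc.prems by (auto simp: G_def)
      have "{q \<in> F. length q = Suc (Suc n)} = insert p {q \<in> G. length q = Suc (Suc n)}" using F p by auto
      then have k: "card {q \<in> G. length q = Suc (Suc n)} = k"
        using F Suc.prems(1) by simp
      show ?case unfolding F(1)
      proof (rule sign_controlled_step[OF F(3) _ _ F(2)])
        fix H :: "(('a \<Rightarrow> real) \<Rightarrow> real) list set"
        assume "finite H" "\<And>q. q \<in> H \<Longrightarrow> int_poly_list q \<and> length q \<le> length p"
          "{q \<in> H. length q = length p} = {q \<in> G. length q = length p}"
        then show "sign_controlled H" using Suc.IH[of H] k p by simp
      qed (use Suc.prems F p in auto)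
    qed
  qed
  moreover have "length cs \<le> Suc (Max (length ` F))" if "cs \<in> F" for cs
    using assms(1) that by (simp add: le_SucI)
  ultimately show ?thesis using assms by blast
qed

section \<open>Quantifier elimination and algebraic points\<close>

lemma int_poly_fun_sum:
  assumes "finite A" "\<And>a. a \<in> A \<Longrightarrow> int_poly_fun (f a)"
  shows "int_poly_fun (\<lambda>e. \<Sum>a\<in>A. f a e)"
  using assms by (induction A rule: finite_induct) (auto intro: int_poly_fun_zero int_poly_fun_add)

lemma int_poly_fun_power: "int_poly_fun f \<Longrightarrow> int_poly_fun (\<lambda>e. f e ^ n)"
  by (induction n) (auto intro: int_poly_fun_one int_poly_fun_mult)

text \<open>\<open>None\<close> marks the coordinates that receive the new value. This covers both
  overwriting one coordinate and the shift of variables under a quantifier.\<close>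

definition extend :: "('j \<Rightarrow> 'i option) \<Rightarrow> ('i \<Rightarrow> real) \<Rightarrow> real \<Rightarrow> 'j \<Rightarrow> real" where
  "extend \<sigma> e x j = (case \<sigma> j of None \<Rightarrow> x | Some i \<Rightarrow> e i)"

text \<open>The degree bound is uniform in \<open>e\<close> so that one coefficient list can
  represent \<open>f e\<close> for all \<open>e\<close>.\<close>

lemma int_poly_fun_extend_aux:
  assumes "int_poly_fun q"
  shows "\<exists>f. (\<forall>i. int_poly_fun (\<lambda>e. coeff (f e) i)) \<and> (\<exists>n. \<forall>e. degree (f e) \<le> n) \<and>
    (\<forall>e x. q (extend \<sigma> e x) = poly (f e) x)"
  using assms
proof induction
  case (int_poly_fun_coord j)
  show ?case
  proof (cases "\<sigma> j")
    case None
    have "int_poly_fun (\<lambda>e. coeff [:0, 1:] i)" for i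
      by (auto simp: coeff_pCons int_poly_fun_zero int_poly_fun_one split: nat.split)
    then show ?thesis using None by (intro exI[of _ "\<lambda>_. [:0, 1:]"]) (auto simp: extend_def)
  next
    case (Some k)
    have "int_poly_fun (\<lambda>e. coeff [:e k:] i)" for i
      by (cases i) (auto intro: int_poly_fun_zero int_poly_fun.intros)
    then show ?thesis using Some by (intro exI[of _ "\<lambda>e. [:e k:]"]) (auto simp: extend_def)
  qed
next
  case int_poly_fun_one
  have "int_poly_fun (\<lambda>e. coeff 1 i)" for i
    by (cases "i = 0") (auto intro: int_poly_fun_zero int_poly_fun.int_poly_fun_one)
  then show ?case by (intro exI[of _ "\<lambda>_. 1"]) (auto simp del: coeff_1)
next
  case (int_poly_fun_diff q r)
  then obtain f g m n where "\<forall>i. int_poly_fun (\<lambda>e. coeff (f e) i)" "\<forall>e. degree (f e) \<le> n"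
    "\<forall>e x. q (extend \<sigma> e x) = poly (f e) x"
    "\<forall>i. int_poly_fun (\<lambda>e. coeff (g e) i)" "\<forall>e. degree (g e) \<le> m"
    "\<forall>e x. r (extend \<sigma> e x) = poly (g e) x" by blast
  then show ?case
    by (intro exI[of _ "\<lambda>e. f e - g e"] conjI exI[of _ "max m n"])
      (auto intro!: int_poly_fun.int_poly_fun_diff degree_diff_le simp: max.coboundedI1 max.coboundedI2)
next
  case (int_poly_fun_mult q r)
  then obtain f g m n where "\<forall>i. int_poly_fun (\<lambda>e. coeff (f e) i)" "\<forall>e. degree (f e) \<le> n"
    "\<forall>e x. q (extend \<sigma> e x) = poly (f e) x"
    "\<forall>i. int_poly_fun (\<lambda>e. coeff (g e) i)" "\<forall>e. degree (g e) \<le> m"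
    "\<forall>e x. r (extend \<sigma> e x) = poly (g e) x" by blast
  then show ?case
    by (intro exI[of _ "\<lambda>e. f e * g e"] conjI exI[of _ "n + m"])
      (auto intro!: int_poly_fun.int_poly_fun_mult int_poly_fun_sum order_trans[OF degree_mult_le] add_mono simp: coeff_mult)
qed

lemma int_poly_fun_extend:
  assumes "int_poly_fun q"
  shows "\<exists>cs. int_poly_list cs \<and> (\<forall>e x. q (extend \<sigma> e x) = poly (poly_at e cs) x)"
proof -
  obtain f n where f: "\<forall>i. int_poly_fun (\<lambda>e. coeff (f e) i)" "\<forall>e. degree (f e) \<le> n"
    "\<forall>e x. q (extend \<sigma> e x) = poly (f e) x" using int_poly_fun_extend_aux[OF assms] by metis
  have "poly_at e (map (\<lambda>i e. coeff (f e) i) [0..<Suc n]) = f e" for e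
  proof (rule poly_at_eqI)
    fix i
    have "coeff (f e) i = 0" if "i \<ge> Suc n"
      using f(2) that by (intro coeff_eq_0) (metis Suc_le_lessD le_less_trans not_less_eq_eq not_le)
    then show "(if i < length (map (\<lambda>i e. coeff (f e) i) [0..<Suc n])
      then (map (\<lambda>i e. coeff (f e) i) [0..<Suc n] ! i) e else 0) = coeff (f e) i"
      by (auto simp del: upt_Suc)
  qed
  then show ?thesis using f
    by (intro exI[of _ "map (\<lambda>i e. coeff (f e) i) [0..<Suc n]"]) (auto simp: int_poly_list_def)
qed

section \<open>Conditions decided by finitely many signs\<close>

text \<open>The semantic form of quantifier-free definability: a Boolean combination of polynomial
  equations and inequalities with integer coefficients.\<close>

definition sign_determined :: "(('i \<Rightarrow> real) \<Rightarrow> bool) \<Rightarrow> bool" where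
  "sign_determined P \<longleftrightarrow> (\<exists>Q. finite Q \<and> (\<forall>q\<in>Q. int_poly_fun q) \<and>
     (\<forall>e e'. same_signs Q e e' \<longrightarrow> P e = P e'))"

lemma sign_determined_binary:
  assumes "sign_determined P" "sign_determined R"
  shows "sign_determined (\<lambda>e. b (P e) (R e))"
proof -
  obtain Q where Q: "finite Q" "\<forall>q\<in>Q. int_poly_fun q" "\<forall>e e'. same_signs Q e e' \<longrightarrow> P e = P e'"
    using assms(1) unfolding sign_determined_def by blast
  obtain Q' where Q': "finite Q'" "\<forall>q\<in>Q'. int_poly_fun q" "\<forall>e e'. same_signs Q' e e' \<longrightarrow> R e = R e'"
    using assms(2) unfolding sign_determined_def by blast
  show ?thesis unfolding sign_determined_def
    using Q Q' by (intro exI[of _ "Q \<union> Q'"]) (auto simp: same_signs_Un)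
qed

lemma sign_determined_const: "sign_determined (\<lambda>e. b)"
  unfolding sign_determined_def by (intro exI[of _ "{}"]) auto

lemma sign_determined_not: "sign_determined P \<Longrightarrow> sign_determined (\<lambda>e. \<not> P e)"
  unfolding sign_determined_def by metis

lemma sign_determined_Ball:
  assumes "finite A" "\<And>a. a \<in> A \<Longrightarrow> sign_determined (P a)"
  shows "sign_determined (\<lambda>e. \<forall>a\<in>A. P a e)"
  using assms
proof (induction A rule: finite_induct)
  case empty
  then show ?case using sign_determined_const[of True] by simp
next
  case (insert a A)
  then show ?case using sign_determined_binary[of "P a" "\<lambda>e. \<forall>a\<in>A. P a e" "(\<and>)"] by simp
qed

lemma sign_determined_eq_0: "int_poly_fun q \<Longrightarrow> sign_determined (\<lambda>e. q e = 0)"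
  unfolding sign_determined_def
  by (intro exI[of _ "{q}"]) (auto simp: same_signs_def, (metis sgn_0_0)+)

lemma sign_determined_less:
  assumes "int_poly_fun f" "int_poly_fun g" shows "sign_determined (\<lambda>e. f e < g e)"
proof -
  have less: "f e < g e \<longleftrightarrow> sgn (f e - g e) = - 1" for e by (simp add: sgn_if)
  show ?thesis unfolding sign_determined_def less
    by (intro exI[of _ "{\<lambda>e. f e - g e}"])
      (simp add: same_signs_def int_poly_fun_diff assms)
qed

text \<open>This is the elimination of a quantifier: a witness \<open>x\<close> at \<open>e\<close>
  is carried to the witness \<open>\<phi> x\<close> at \<open>e'\<close>, and the symmetry of
  \<open>same_signs\<close> gives the converse.\<close>

lemma sign_determined_ex:
  assumes "sign_determined P"
  shows "sign_determined (\<lambda>e. \<exists>x. P (extend \<sigma> e x))"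
proof -
  obtain Q where Q: "finite Q" "\<forall>q\<in>Q. int_poly_fun q" "\<forall>e e'. same_signs Q e e' \<longrightarrow> P e = P e'"
    using assms unfolding sign_determined_def by blast
  obtain l where l: "\<forall>q\<in>Q. int_poly_list (l q) \<and> (\<forall>e x. q (extend \<sigma> e x) = poly (poly_at e (l q)) x)"
    using Q(2) int_poly_fun_extend by metis
  have "sign_controlled (l ` Q)" using Q(1) l by (intro sign_controlled) auto
  then obtain R where R: "finite R" "\<forall>q\<in>R. int_poly_fun q" "\<forall>e e'. same_signs R e e' \<longrightarrow> matches (l ` Q) e e'"
    unfolding sign_controlled_def by blast
  have imp: "\<exists>x. P (extend \<sigma> e' x)" if s: "same_signs R e e'" and x: "P (extend \<sigma> e x)" for e e' x
  proof -
    obtain \<phi> where "\<forall>cs\<in>l ` Q. \<forall>x. sgn (poly (poly_at e cs) x) = sgn (poly (poly_at e' cs) (\<phi> x))"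
      using R(3) s unfolding matches_def by blast
    then have "same_signs Q (extend \<sigma> e x) (extend \<sigma> e' (\<phi> x))"
      using l by (auto simp: same_signs_def)
    then have "P (extend \<sigma> e' (\<phi> x))" using Q(3) x by simp
    then show ?thesis by (rule exI)
  qed
  have "(\<exists>x. P (extend \<sigma> e x)) = (\<exists>x. P (extend \<sigma> e' x))" if "same_signs R e e'" for e e'
    using imp[OF that] imp[OF same_signs_sym[OF that]] by metis
  then show ?thesis unfolding sign_determined_def
    using R(1,2) by (intro exI[of _ R]) simp
qed

lemma sign_determined_project:
  assumes "finite J" "sign_determined P"
  shows "sign_determined (\<lambda>e. \<exists>e'. P e' \<and> (\<forall>j. j \<notin> J \<longrightarrow> e' j = e j))"
  using assms(1)
proof (induction J rule: finite_induct)
  case empty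
  have "(\<lambda>e. \<exists>e'. P e' \<and> (\<forall>j. j \<notin> {} \<longrightarrow> e' j = e j)) = P" by (auto simp: fun_eq_iff[symmetric])
  then show ?case using assms(2) by simp
next
  case (insert k J)
  define \<sigma> where "\<sigma> j = (if j = k then None else Some j)" for j
  have \<sigma>: "extend \<sigma> e x j = (if j = k then x else e j)" for e x j
    by (simp add: extend_def \<sigma>_def)
  have "(\<exists>e'. P e' \<and> (\<forall>j. j \<notin> insert k J \<longrightarrow> e' j = e j)) \<longleftrightarrow>
    (\<exists>x. \<exists>e'. P e' \<and> (\<forall>j. j \<notin> J \<longrightarrow> e' j = extend \<sigma> e x j))" for e
    unfolding \<sigma> using insert.hyps(2) by (metis insert_iff)
  then show ?case using sign_determined_ex[OF insert.IH, of \<sigma>] by simp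
qed

section \<open>Algebraic points of sign-determined sets\<close>

lemma int_poly_fun_diagonal:
  assumes "int_poly_fun q"
  shows "\<exists>r :: real poly. (\<forall>i. coeff r i \<in> \<int>) \<and> (\<forall>x. q (\<lambda>_. x) = poly r x)"
  using assms
proof induction
  case (int_poly_fun_coord i)
  show ?case by (intro exI[of _ "[:0, 1:]"]) (auto simp: coeff_pCons split: nat.split)
next
  case int_poly_fun_one
  show ?case by (intro exI[of _ 1]) auto
next
  case (int_poly_fun_diff f g)
  then obtain r s where "\<forall>i. coeff r i \<in> \<int>" "\<forall>x. f (\<lambda>_. x) = poly r x"
    "\<forall>i. coeff s i \<in> \<int>" "\<forall>x. g (\<lambda>_. x) = poly s x" by blast
  then show ?case by (intro exI[of _ "r - s"]) auto
next
  case (int_poly_fun_mult f g)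
  then obtain r s where "\<forall>i. coeff r i \<in> \<int>" "\<forall>x. f (\<lambda>_. x) = poly r x"
    "\<forall>i. coeff s i \<in> \<int>" "\<forall>x. g (\<lambda>_. x) = poly s x" by blast
  then show ?case by (intro exI[of _ "r * s"]) (auto simp: coeff_mult intro!: Ints_sum)
qed

text \<open>A transcendental \<open>x\<close> is a root of no nonzero integer polynomial, so all
  signs are constant near \<open>x\<close>, and there are rationals nearby.\<close>

lemma algebraic_same_signs:
  fixes x :: real
  assumes Q: "finite Q" "\<forall>q\<in>Q. int_poly_fun q"
  shows "\<exists>b. algebraic b \<and> same_signs Q (\<lambda>_. x) (\<lambda>_. b)"
proof (cases "algebraic x")
  case True
  then show ?thesis by (auto simp: same_signs_def)
next
  case False
  have "\<forall>\<^sub>F t in nhds x. sgn (q (\<lambda>_. x)) = sgn (q (\<lambda>_. t))" if "q \<in> Q" for q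
  proof -
    have "int_poly_fun q" using Q(2) that by blast
    from int_poly_fun_diagonal[OF this] obtain r :: "real poly"
      where r: "\<forall>i. coeff r i \<in> \<int>" "\<forall>x. q (\<lambda>_. x) = poly r x" by (elim exE conjE)
    have tendsto: "(poly r \<longlongrightarrow> poly r x) (nhds x)"
      using poly_isCont[of x r] by (simp add: continuous_at tendsto_nhds_iff)
    have "r = 0 \<or> poly r x \<noteq> 0" using False r(1) unfolding algebraic_def by blast
    then consider "r = 0" | "poly r x > 0" | "poly r x < 0"
      by (metis linorder_less_linear)
    then show ?thesis
    proof cases
      case 1 then show ?thesis by (simp add: r)
    next
      case 2
      show ?thesis
        by (rule eventually_mono[OF order_tendstoD(1)[OF tendsto 2]]) (use 2 r in auto)
    next
      case 3
      show ?thesis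
        by (rule eventually_mono[OF order_tendstoD(2)[OF tendsto 3]]) (use 3 r in auto)
    qed
  qed
  then have "\<forall>\<^sub>F t in nhds x. \<forall>q\<in>Q. sgn (q (\<lambda>_. x)) = sgn (q (\<lambda>_. t))"
    using Q(1) by (simp add: eventually_ball_finite)
  then obtain d where d: "d > 0" "\<And>t. dist t x < d \<Longrightarrow> same_signs Q (\<lambda>_. x) (\<lambda>_. t)"
    unfolding eventually_nhds_metric same_signs_def by auto
  obtain b where b: "b \<in> \<rat>" "x < b" "b < x + d" using Rats_dense_in_real[of x "x + d"] d(1) by auto
  then have "same_signs Q (\<lambda>_. x) (\<lambda>_. b)" by (intro d(2)) (simp add: dist_real_def)
  then show ?thesis using b rat_imp_algebraic by blast
qed

lemma sign_determined_Rats_bounds: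
  assumes "c \<in> \<rat>"
  shows "sign_determined (\<lambda>e. e i < c)" "sign_determined (\<lambda>e. c < e i)"
proof -
  obtain a b :: int where ab: "b > 0" "c = of_int a / of_int b"
    using assms by (metis Rats_cases')
  have "e i < c \<longleftrightarrow> e i * of_int b < of_int a" "c < e i \<longleftrightarrow> of_int a < e i * of_int b" for e
    using ab by (simp_all add: pos_less_divide_eq pos_divide_less_eq)
  then show "sign_determined (\<lambda>e. e i < c)" "sign_determined (\<lambda>e. c < e i)"
    by (auto intro!: sign_determined_less int_poly_fun_mult int_poly_fun_coord int_poly_fun_of_int)
qed

text \<open>An algebraic number is definable without parameters, as the only root of some integer
  polynomial between two rational bounds.\<close>

lemma sign_determined_eq_algebraic:
  assumes "algebraic b"
  shows "sign_determined (\<lambda>e. e i = b)"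
proof -
  obtain r where r: "\<forall>i. coeff r i \<in> \<int>" "r \<noteq> 0" "poly r b = 0"
    using assms unfolding algebraic_def by blast
  define Z where "Z = {x. poly r x = 0}"
  have Z: "finite Z" using r(2) by (simp add: Z_def poly_roots_finite)
  \<comment> \<open>\<open>b - 1\<close> and \<open>b + 1\<close> keep the two sets nonempty when no
    other root lies on that side.\<close>
  define L U where "L = Max (insert (b - 1) {x \<in> Z. x < b})" and "U = Min (insert (b + 1) {x \<in> Z. x > b})"
  have "L < b" unfolding L_def using Z by (subst Max_less_iff) auto
  then obtain l where l: "l \<in> \<rat>" "L < l" "l < b" using Rats_dense_in_real by blast
  have "U > b" unfolding U_def using Z by (subst Min_gr_iff) auto
  then obtain u where u: "u \<in> \<rat>" "b < u" "u < U" using Rats_dense_in_real by blast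
  have lZ: "x < l" if "x \<in> Z" "x < b" for x
  proof -
    have "x \<le> L" unfolding L_def by (rule Max_ge) (use Z that in auto)
    then show ?thesis using l by simp
  qed
  have uZ: "x > u" if "x \<in> Z" "x > b" for x
  proof -
    have "U \<le> x" unfolding U_def by (rule Min_le) (use Z that in auto)
    then show ?thesis using u by simp
  qed
  have iff: "x = b \<longleftrightarrow> poly r x = 0 \<and> l < x \<and> x < u" for x
    using lZ[of x] uZ[of x] l u r(3) by (cases x b rule: linorder_cases) (auto simp: Z_def)
  have "int_poly_fun (\<lambda>e. coeff r j)" for j
  proof -
    obtain k where "coeff r j = of_int k" using r(1) by (metis Ints_cases)
    then show ?thesis using int_poly_fun_of_int by simp
  qed
  then have "int_poly_fun (\<lambda>e. poly r (e i))" unfolding poly_altdef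
    by (intro int_poly_fun_sum int_poly_fun_mult int_poly_fun_power int_poly_fun_coord) auto
  then show ?thesis unfolding iff
    by (intro sign_determined_binary[of _ _ "(\<and>)"] sign_determined_eq_0 sign_determined_Rats_bounds l u)
qed

text \<open>Projecting away the rest of \<open>I\<close> leaves a condition on coordinate
  \<open>i\<close> and on coordinates outside \<open>I\<close>, to which \<open>P\<close> is
  insensitive. It can therefore be tested at constant environments, that is, at a single
  real.\<close>

lemma exists_algebraic_coordinate:
  fixes P :: "('i \<Rightarrow> real) \<Rightarrow> bool"
  assumes P: "sign_determined P" and I: "finite I" and "P e"
    and dep: "\<And>e e'. (\<And>i. i \<in> I \<Longrightarrow> e i = e' i) \<Longrightarrow> P e = P e'"
  shows "\<exists>e'. P e' \<and> algebraic (e' i)"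
proof -
  define X where "X e \<longleftrightarrow> (\<exists>e'. P e' \<and> (\<forall>j. j \<notin> I - {i} \<longrightarrow> e' j = e j))" for e
  have "sign_determined X" unfolding X_def using sign_determined_project[of "I - {i}"] P I by simp
  then obtain Q where Q: "finite Q" "\<forall>q\<in>Q. int_poly_fun q" "\<forall>e e'. same_signs Q e e' \<longrightarrow> X e = X e'"
    unfolding sign_determined_def by blast
  obtain b where b: "algebraic b" "same_signs Q (\<lambda>_. e i) (\<lambda>_. b)"
    using algebraic_same_signs[OF Q(1,2)] by blast
  have "P (\<lambda>j. if j \<in> I then e j else e i)"
    using dep[of e "\<lambda>j. if j \<in> I then e j else e i"] \<open>P e\<close> by simp
  then have "X (\<lambda>_. e i)" unfolding X_def
    by (intro exI[of _ "\<lambda>j. if j \<in> I then e j else e i"]) auto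
  then have "X (\<lambda>_. b)" using Q(3) b(2) by blast
  then show ?thesis using b(1) unfolding X_def by auto
qed

text \<open>Coordinates become algebraic one at a time. A value found is frozen by adding the
  condition \<open>e i = e1 i\<close>, which is sign-determined because \<open>e1 i\<close> is
  algebraic, so later changes keep it.\<close>

theorem exists_algebraic_point:
  fixes P :: "('i \<Rightarrow> real) \<Rightarrow> bool"
  assumes "finite K" "K \<subseteq> I" "finite I" "sign_determined P" "P e"
    and "\<And>e e'. (\<And>i. i \<in> I \<Longrightarrow> e i = e' i) \<Longrightarrow> P e = P e'"
  shows "\<exists>e'. P e' \<and> (\<forall>i\<in>K. algebraic (e' i))"
  using assms
proof (induction K arbitrary: P e rule: finite_induct)
  case empty
  show ?case using empty.prems(4) by blast
next
  case (insert i K)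
  have "\<exists>e1. P e1 \<and> algebraic (e1 i)"
    by (rule exists_algebraic_coordinate[OF insert.prems(3,2,4)]) (rule insert.prems(5))
  then obtain e1 where e1: "P e1" "algebraic (e1 i)" by blast
  have "\<exists>e'. (P e' \<and> e' i = e1 i) \<and> (\<forall>i\<in>K. algebraic (e' i))"
  proof (rule insert.IH)
    show "sign_determined (\<lambda>e. P e \<and> e i = e1 i)"
      by (intro sign_determined_binary[of _ _ "(\<and>)"] sign_determined_eq_algebraic e1(2) insert.prems(3))
    show "P e1 \<and> e1 i = e1 i" using e1(1) by simp
    show "(P e \<and> e i = e1 i) = (P e' \<and> e' i = e1 i)" if eq: "\<And>i. i \<in> I \<Longrightarrow> e i = e' i" for e e'
    proof -
      have "P e = P e'" by (rule insert.prems(5)) (rule eq)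
      moreover have "e i = e' i" using insert.prems(1) by (intro eq) simp
      ultimately show ?thesis by simp
    qed
    show "K \<subseteq> I" "finite I" using insert.prems(1,2) by simp_all
  qed
  then obtain e' where "P e'" "e' i = e1 i" "\<forall>i\<in>K. algebraic (e' i)" by blast
  then show ?case using e1(2) by (intro exI[of _ e']) simp
qed

text \<open>Terms are not rational functions because of \<open>x / 0 = 0\<close>, but they are so on each of finitely
  many sign cells of the parameters.\<close>

definition piecewise_rational :: "(('i \<Rightarrow> real) \<Rightarrow> real) \<Rightarrow> bool" where
  "piecewise_rational f \<longleftrightarrow> (\<exists>Q R. finite Q \<and> (\<forall>q\<in>Q. int_poly_fun q) \<and>
     finite R \<and> (\<forall>N D. (N, D) \<in> R \<longrightarrow> int_poly_fun N \<and> int_poly_fun D) \<and>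
     (\<forall>e. \<exists>N D. (N, D) \<in> R \<and> (\<forall>e'. same_signs Q e e' \<longrightarrow> D e' \<noteq> 0 \<and> f e' = N e' / D e')))"

lemma piecewise_rationalI:
  assumes "finite Q" "\<And>q. q \<in> Q \<Longrightarrow> int_poly_fun q" "finite R"
    "\<And>N D. (N, D) \<in> R \<Longrightarrow> int_poly_fun N \<and> int_poly_fun D"
    "\<And>e. \<exists>N D. (N, D) \<in> R \<and> (\<forall>e'. same_signs Q e e' \<longrightarrow> D e' \<noteq> 0 \<and> f e' = N e' / D e')"
  shows "piecewise_rational f"
  unfolding piecewise_rational_def
  by (intro exI[of _ Q] exI[of _ R]) (use assms in simp)

lemma piecewise_rational_int_poly_fun:
  assumes "int_poly_fun f" shows "piecewise_rational f"
  by (rule piecewise_rationalI[of "{}" "{(f, \<lambda>_. 1)}"]) (use assms int_poly_fun_one in auto)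

text \<open>The cells of \<open>f\<close> and \<open>g\<close> are refined to common ones;
  \<open>n\<close> and \<open>d\<close> compute numerator and denominator of the result from those
  of the arguments.\<close>

lemma piecewise_rational_binary:
  fixes f g :: "('i \<Rightarrow> real) \<Rightarrow> real" and n d :: "real \<Rightarrow> real \<Rightarrow> real \<Rightarrow> real \<Rightarrow> real"
  assumes f: "piecewise_rational f" and g: "piecewise_rational g"
    and nd: "\<And>N D N' D' :: ('i \<Rightarrow> real) \<Rightarrow> real. int_poly_fun N \<Longrightarrow> int_poly_fun D \<Longrightarrow> int_poly_fun N' \<Longrightarrow> int_poly_fun D' \<Longrightarrow>
      int_poly_fun (\<lambda>e. n (N e) (D e) (N' e) (D' e)) \<and> int_poly_fun (\<lambda>e. d (N e) (D e) (N' e) (D' e))"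
    and op: "\<And>a b a' b'. b \<noteq> 0 \<Longrightarrow> b' \<noteq> 0 \<Longrightarrow>
      d a b a' b' \<noteq> 0 \<and> h (a / b) (a' / b') = n a b a' b' / d a b a' b'"
  shows "piecewise_rational (\<lambda>e. h (f e) (g e))"
proof -
  obtain Q R where Q: "finite Q" "\<forall>q\<in>Q. int_poly_fun q" and R: "finite R"
    "\<forall>N D. (N, D) \<in> R \<longrightarrow> int_poly_fun N \<and> int_poly_fun D"
    and QR: "\<forall>e. \<exists>N D. (N, D) \<in> R \<and> (\<forall>e'. same_signs Q e e' \<longrightarrow> D e' \<noteq> 0 \<and> f e' = N e' / D e')"
    using f unfolding piecewise_rational_def by (elim exE conjE)
  obtain Q' R' where Q': "finite Q'" "\<forall>q\<in>Q'. int_poly_fun q" and R': "finite R'"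
    "\<forall>N D. (N, D) \<in> R' \<longrightarrow> int_poly_fun N \<and> int_poly_fun D"
    and QR': "\<forall>e. \<exists>N D. (N, D) \<in> R' \<and> (\<forall>e'. same_signs Q' e e' \<longrightarrow> D e' \<noteq> 0 \<and> g e' = N e' / D e')"
    using g unfolding piecewise_rational_def by (elim exE conjE)
  define C where "C = (\<lambda>((N, D), (N', D')).
    (\<lambda>e. n (N e) (D e) (N' e) (D' e), \<lambda>e::'i \<Rightarrow> real. d (N e) (D e) (N' e) (D' e)))"
  show ?thesis
  proof (rule piecewise_rationalI[of "Q \<union> Q'" "C ` (R \<times> R')"])
    fix N D assume "(N, D) \<in> C ` (R \<times> R')"
    then obtain A B A' B' where "(A, B) \<in> R" "(A', B') \<in> R'"
      and ND: "N = (\<lambda>e. n (A e) (B e) (A' e) (B' e))" "D = (\<lambda>e. d (A e) (B e) (A' e) (B' e))"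
      by (auto simp: C_def)
    then have "int_poly_fun A" "int_poly_fun B" "int_poly_fun A'" "int_poly_fun B'"
      using R(2) R'(2) by auto
    from nd[OF this] show "int_poly_fun N \<and> int_poly_fun D" unfolding ND .
  next
    fix e
    obtain N D where ND: "(N, D) \<in> R" "\<And>e'. same_signs Q e e' \<Longrightarrow> D e' \<noteq> 0 \<and> f e' = N e' / D e'"
      using QR[rule_format, of e] by auto
    obtain N' D' where ND': "(N', D') \<in> R'" "\<And>e'. same_signs Q' e e' \<Longrightarrow> D' e' \<noteq> 0 \<and> g e' = N' e' / D' e'"
      using QR'[rule_format, of e] by auto
    define A B where "A = (\<lambda>e. n (N e) (D e) (N' e) (D' e))" and "B = (\<lambda>e. d (N e) (D e) (N' e) (D' e))"
    have "C ((N, D), (N', D')) \<in> C ` (R \<times> R')" using ND(1) ND'(1) by blast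
    then have mem: "(A, B) \<in> C ` (R \<times> R')" by (simp add: C_def A_def B_def)
    have "B e' \<noteq> 0 \<and> h (f e') (g e') = A e' / B e'" if "same_signs (Q \<union> Q') e e'" for e'
      using that op[of "D e'" "D' e'" "N e'" "N' e'"] ND(2)[of e'] ND'(2)[of e']
      by (simp add: same_signs_Un A_def B_def)
    with mem show "\<exists>N D. (N, D) \<in> C ` (R \<times> R') \<and> (\<forall>e'. same_signs (Q \<union> Q') e e' \<longrightarrow>
      D e' \<noteq> 0 \<and> h (f e') (g e') = N e' / D e')"
      by (intro exI[of _ A] exI[of _ B]) simp
  qed (use Q Q' R R' in auto)
qed

lemma piecewise_rational_diff:
  assumes "piecewise_rational f" "piecewise_rational g"
  shows "piecewise_rational (\<lambda>e. f e - g e)"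
  by (rule piecewise_rational_binary[where n = "\<lambda>a b a' b'. a * b' - a' * b" and d = "\<lambda>a b a' b'. b * b'", OF assms])
    (auto intro!: int_poly_fun_diff int_poly_fun_mult simp: diff_frac_eq)

lemma piecewise_rational_add:
  assumes "piecewise_rational f" "piecewise_rational g"
  shows "piecewise_rational (\<lambda>e. f e + g e)"
  by (rule piecewise_rational_binary[where n = "\<lambda>a b a' b'. a * b' + a' * b" and d = "\<lambda>a b a' b'. b * b'", OF assms])
    (auto intro!: int_poly_fun_add int_poly_fun_mult simp: add_frac_eq)

lemma piecewise_rational_mult:
  assumes "piecewise_rational f" "piecewise_rational g"
  shows "piecewise_rational (\<lambda>e. f e * g e)"
  by (rule piecewise_rational_binary[where n = "\<lambda>a b a' b'. a * a'" and d = "\<lambda>a b a' b'. b * b'", OF assms])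
    (auto intro!: int_poly_fun_mult)

text \<open>The cells are refined by the signs of all numerators. Where the numerator vanishes,
  division by zero gives \<open>0 / 1\<close>; elsewhere numerator and denominator are
  swapped.\<close>

lemma piecewise_rational_inverse:
  assumes "piecewise_rational f"
  shows "piecewise_rational (\<lambda>e. inverse (f e))"
proof -
  obtain Q R where Q: "finite Q" "\<forall>q\<in>Q. int_poly_fun q" and R: "finite R"
    "\<forall>N D. (N, D) \<in> R \<longrightarrow> int_poly_fun N \<and> int_poly_fun D"
    and QR: "\<forall>e. \<exists>N D. (N, D) \<in> R \<and> (\<forall>e'. same_signs Q e e' \<longrightarrow> D e' \<noteq> 0 \<and> f e' = N e' / D e')"
    using assms unfolding piecewise_rational_def by (elim exE conjE)
  let ?R = "insert (\<lambda>_. 0, \<lambda>_. 1) (prod.swap ` R)"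
  show ?thesis
  proof (rule piecewise_rationalI[of "Q \<union> fst ` R" ?R])
    fix N D assume "(N, D) \<in> ?R"
    then show "int_poly_fun N \<and> int_poly_fun D"
      using R(2) int_poly_fun_zero int_poly_fun_one by auto
  next
    fix e
    obtain N D where ND: "(N, D) \<in> R" "\<And>e'. same_signs Q e e' \<Longrightarrow> D e' \<noteq> 0 \<and> f e' = N e' / D e'"
      using QR[rule_format, of e] by auto
    have sgn: "sgn (N e) = sgn (N e')" if "same_signs (Q \<union> fst ` R) e e'" for e'
      by (rule same_signsD[OF that]) (use image_eqI[OF _ ND(1), of N fst] in simp)
    show "\<exists>N D. (N, D) \<in> ?R \<and> (\<forall>e'. same_signs (Q \<union> fst ` R) e e' \<longrightarrow>
      D e' \<noteq> 0 \<and> inverse (f e') = N e' / D e')"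
    proof (cases "N e = 0")
      case True
      then have "N e' = 0" if "same_signs (Q \<union> fst ` R) e e'" for e'
        using sgn[OF that] by (simp add: sgn_0_0)
      then show ?thesis using ND(2)
        by (intro exI[of _ "\<lambda>_. 0"] exI[of _ "\<lambda>_. 1"]) (simp add: same_signs_Un)
    next
      case False
      then have "N e' \<noteq> 0" if "same_signs (Q \<union> fst ` R) e e'" for e'
        using sgn[OF that] by (metis sgn_0_0)
      moreover have "(D, N) \<in> ?R" using image_eqI[OF _ ND(1), of "(D, N)" prod.swap] by simp
      ultimately show ?thesis using ND(2)
        by (intro exI[of _ D] exI[of _ N]) (simp add: same_signs_Un)
    qed
  qed (use Q R in auto)
qed

lemma piecewise_rational_divide:
  assumes "piecewise_rational f" "piecewise_rational g"
  shows "piecewise_rational (\<lambda>e. f e / g e)"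
  using piecewise_rational_mult[OF assms(1) piecewise_rational_inverse[OF assms(2)]]
  by (simp add: divide_inverse)

lemma sign_determined_sgn:
  assumes "piecewise_rational f"
  shows "sign_determined (\<lambda>e. b (sgn (f e)))"
proof -
  obtain Q R where Q: "finite Q" "\<forall>q\<in>Q. int_poly_fun q" and R: "finite R"
    "\<forall>N D. (N, D) \<in> R \<longrightarrow> int_poly_fun N \<and> int_poly_fun D"
    and QR: "\<forall>e. \<exists>N D. (N, D) \<in> R \<and> (\<forall>e'. same_signs Q e e' \<longrightarrow> D e' \<noteq> 0 \<and> f e' = N e' / D e')"
    using assms unfolding piecewise_rational_def by (elim exE conjE)
  have "sgn (f e) = sgn (f e')" if s: "same_signs (Q \<union> fst ` R \<union> snd ` R) e e'" for e e'
  proof -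
    obtain N D where ND: "(N, D) \<in> R" "\<And>e'. same_signs Q e e' \<Longrightarrow> D e' \<noteq> 0 \<and> f e' = N e' / D e'"
      using QR[rule_format, of e] by auto
    have "N \<in> fst ` R" "D \<in> snd ` R"
      using image_eqI[OF _ ND(1), of N fst] image_eqI[OF _ ND(1), of D snd] by simp_all
    then have "sgn (N e) = sgn (N e')" "sgn (D e) = sgn (D e')"
      using same_signsD[OF s] by simp_all
    moreover have "f e = N e / D e" "f e' = N e' / D e'"
      using ND(2)[of e] ND(2)[of e'] s by (simp_all add: same_signs_def)
    ultimately show ?thesis by (simp add: sgn_divide)
  qed
  then have "\<forall>e e'. same_signs (Q \<union> fst ` R \<union> snd ` R) e e' \<longrightarrow> b (sgn (f e)) = b (sgn (f e'))"
    by metis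
  moreover have "\<forall>q\<in>Q \<union> fst ` R \<union> snd ` R. int_poly_fun q" using Q R by auto
  ultimately show ?thesis unfolding sign_determined_def
    using Q(1) R(1) by (intro exI[of _ "Q \<union> fst ` R \<union> snd ` R"]) simp
qed

section \<open>Renaming scalars in formulas and proofs\<close>

fun map_fsym :: "(real \<Rightarrow> real) \<Rightarrow> fsym \<Rightarrow> fsym" where
  "map_fsym h (Scal a) = Scal (h a)"
| "map_fsym h f = f"

fun map_scal_trm :: "(real \<Rightarrow> real) \<Rightarrow> trm \<Rightarrow> trm" where
  "map_scal_trm h (Var n) = Var n"
| "map_scal_trm h (App f ts) = App (map_fsym h f) (map (map_scal_trm h) ts)"

fun map_scal_fm :: "(real \<Rightarrow> real) \<Rightarrow> fm \<Rightarrow> fm" where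
  "map_scal_fm h FF = FF"
| "map_scal_fm h (Eq s t) = Eq (map_scal_trm h s) (map_scal_trm h t)"
| "map_scal_fm h (Less s t) = Less (map_scal_trm h s) (map_scal_trm h t)"
| "map_scal_fm h (Imp p q) = Imp (map_scal_fm h p) (map_scal_fm h q)"
| "map_scal_fm h (All p) = All (map_scal_fm h p)"

fun scals_trm :: "trm \<Rightarrow> real set" where
  "scals_trm (Var n) = {}"
| "scals_trm (App f ts) = {a. f = Scal a} \<union> (\<Union>t\<in>set ts. scals_trm t)"

fun scals_fm :: "fm \<Rightarrow> real set" where
  "scals_fm FF = {}"
| "scals_fm (Eq s t) = scals_trm s \<union> scals_trm t"
| "scals_fm (Less s t) = scals_trm s \<union> scals_trm t"
| "scals_fm (Imp p q) = scals_fm p \<union> scals_fm q"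
| "scals_fm (All p) = scals_fm p"

lemma finite_scals_trm: "finite (scals_trm t)"
proof (induction t)
  case (App f ts)
  have "finite {a. f = Scal a}" by (cases f) auto
  then show ?case using App by auto
qed simp

lemma finite_scals_fm: "finite (scals_fm p)"
  by (induction p) (auto simp: finite_scals_trm)

lemma map_fsym_cong: "(\<And>a. f = Scal a \<Longrightarrow> h a = h' a) \<Longrightarrow> map_fsym h f = map_fsym h' f"
  by (cases f) auto

lemma map_scal_trm_cong: "(\<And>a. a \<in> scals_trm t \<Longrightarrow> h a = h' a) \<Longrightarrow> map_scal_trm h t = map_scal_trm h' t"
  by (induction t) (auto intro: map_fsym_cong)

lemma map_scal_fm_cong: "(\<And>a. a \<in> scals_fm p \<Longrightarrow> h a = h' a) \<Longrightarrow> map_scal_fm h p = map_scal_fm h' p"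
  by (induction p) (auto intro: map_scal_trm_cong)

lemma map_scal_trm_id: "map_scal_trm (\<lambda>a. a) t = t"
proof (induction t)
  case (App f ts)
  then show ?case by (cases f) (simp_all add: map_idI)
qed simp

lemma map_scal_fm_id: "map_scal_fm (\<lambda>a. a) p = p"
  by (induction p) (simp_all add: map_scal_trm_id)

lemma scals_trm_subset: "wf_trm L t \<Longrightarrow> scals_trm t \<subseteq> {a. Scal a \<in> L}"
  by (induction t) auto

lemma scals_fm_subset: "wf_fm L p \<Longrightarrow> scals_fm p \<subseteq> {a. Scal a \<in> L}"
  by (induction p) (use scals_trm_subset in auto)

lemma arity_map_fsym: "arity (map_fsym h f) = arity f"
  by (cases f) simp_all

lemma wf_map_scal_trm: "wf_trm L t \<Longrightarrow> map_fsym h ` L \<subseteq> L' \<Longrightarrow> wf_trm L' (map_scal_trm h t)"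
  by (induction t) (auto simp: arity_map_fsym)

lemma wf_map_scal_fm: "wf_fm L p \<Longrightarrow> map_fsym h ` L \<subseteq> L' \<Longrightarrow> wf_fm L' (map_scal_fm h p)"
  by (induction p) (auto intro: wf_map_scal_trm)

lemma closed_map_scal_trm: "closed_trm k (map_scal_trm h t) = closed_trm k t"
  by (induction t) auto

lemma closed_map_scal_fm: "closed_fm k (map_scal_fm h p) = closed_fm k p"
  by (induction p arbitrary: k) (simp_all add: closed_map_scal_trm)

lemma map_scal_lift_trm: "map_scal_trm h (lift_trm k t) = lift_trm k (map_scal_trm h t)"
  by (induction t) auto

lemma map_scal_lift_fm: "map_scal_fm h (lift_fm k p) = lift_fm k (map_scal_fm h p)"
  by (induction p arbitrary: k) (simp_all add: map_scal_lift_trm)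

lemma map_scal_subst_trm:
  "map_scal_trm h (subst_trm k s t) = subst_trm k (map_scal_trm h s) (map_scal_trm h t)"
  by (induction t) auto

lemma map_scal_subst_fm:
  "map_scal_fm h (subst_fm k s p) = subst_fm k (map_scal_trm h s) (map_scal_fm h p)"
  by (induction p arbitrary: k s) (simp_all add: map_scal_subst_trm map_scal_lift_trm)

section \<open>Truth as a condition on the values of the scalars\<close>

lemma teval_closed: "closed_trm k t \<Longrightarrow> (\<And>n. n < k \<Longrightarrow> e n = e' n) \<Longrightarrow> teval e t = teval e' t"
proof (induction t)
  case (App f ts)
  then have "map (teval e) ts = map (teval e') ts" by auto
  then show ?case by (simp only: teval.simps)
qed simp

lemma holds_closed: "closed_fm k p \<Longrightarrow> (\<And>n. n < k \<Longrightarrow> e n = e' n) \<Longrightarrow> holds e p = holds e' p"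
proof (induction p arbitrary: k e e')
  case (Eq s t)
  then show ?case using teval_closed[of k s e e'] teval_closed[of k t e e'] by simp
next
  case (Less s t)
  then show ?case using teval_closed[of k s e e'] teval_closed[of k t e e'] by simp
next
  case (Imp p q)
  then show ?case using Imp.IH(1)[of k e e'] Imp.IH(2)[of k e e'] by simp
next
  case (All p)
  have "holds (shift_env x e) p = holds (shift_env x e') p" for x
    using All.prems by (intro All.IH[of "Suc k"]) (auto simp: shift_env_def split: nat.split)
  then show ?case by simp
qed simp

text \<open>Scalars and variables are coordinates on an equal footing, so scalar multiplication
  becomes a product of functions of \<open>E\<close> and no real parameter remains.\<close>

lemma piecewise_rational_teval:
  fixes t :: trm
  assumes "wf_trm L t"
  shows "piecewise_rational (\<lambda>E :: real + nat \<Rightarrow> real. teval (\<lambda>n. E (Inr n)) (map_scal_trm (\<lambda>a. E (Inl a)) t))"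
  using assms
proof (induction t)
  case (Var n)
  show ?case by (simp add: piecewise_rational_int_poly_fun int_poly_fun_coord)
next
  case (App f ts)
  have binary: "\<exists>s t. ts = [s, t]" if "arity f = 2"
    using App.prems that by (auto simp: numeral_2_eq_2 length_Suc_conv)
  note int_poly = piecewise_rational_int_poly_fun int_poly_fun_coord int_poly_fun_zero int_poly_fun_one
  show ?case
  proof (cases f)
    case (Scal a)
    then obtain t where "ts = [t]" using App.prems by (auto simp: length_Suc_conv)
    then show ?thesis using Scal App
      by (auto intro!: piecewise_rational_mult piecewise_rational_int_poly_fun[OF int_poly_fun_coord])
  next
    case Add then show ?thesis using binary App by (auto intro!: piecewise_rational_add)
  next
    case Sub then show ?thesis using binary App by (auto intro!: piecewise_rational_diff)
  next
    case Mul then show ?thesis using binary App by (auto intro!: piecewise_rational_mult)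
  next
    case Dvd then show ?thesis using binary App by (auto intro!: piecewise_rational_divide)
  qed (simp_all add: int_poly)
qed

text \<open>The environment \<open>E\<close> holds the values of the scalars (\<open>Inl\<close>) and of the variables (\<open>Inr\<close>).\<close>

lemma sign_determined_holds:
  assumes "wf_fm L p"
  shows "sign_determined (\<lambda>E :: real + nat \<Rightarrow> real. holds (\<lambda>n. E (Inr n)) (map_scal_fm (\<lambda>a. E (Inl a)) p))"
  using assms
proof (induction p)
  case FF
  show ?case by (simp add: sign_determined_const)
next
  case (Eq s t)
  then have "sign_determined (\<lambda>E :: real + nat \<Rightarrow> real. sgn (teval (\<lambda>n. E (Inr n)) (map_scal_trm (\<lambda>a. E (Inl a)) s)
      - teval (\<lambda>n. E (Inr n)) (map_scal_trm (\<lambda>a. E (Inl a)) t)) = 0)"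
    by (intro sign_determined_sgn piecewise_rational_diff piecewise_rational_teval) auto
  then show ?case by (simp add: sgn_0_0)
next
  case (Less s t)
  then have "sign_determined (\<lambda>E :: real + nat \<Rightarrow> real. sgn (teval (\<lambda>n. E (Inr n)) (map_scal_trm (\<lambda>a. E (Inl a)) s)
      - teval (\<lambda>n. E (Inr n)) (map_scal_trm (\<lambda>a. E (Inl a)) t)) < 0)"
    by (intro sign_determined_sgn[where b = "\<lambda>x. x < 0"] piecewise_rational_diff piecewise_rational_teval) auto
  then show ?case by simp
next
  case (Imp p q)
  then show ?case by (auto intro!: sign_determined_binary[where b = "(\<longrightarrow>)"])
next
  case (All p)
  \<comment> \<open>A de Bruijn shift: variable \<open>0\<close> is the quantified one, variable
    \<open>Suc m\<close> is read as the outer variable \<open>m\<close>, and the scalars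
    stay.\<close>
  define \<sigma> :: "real + nat \<Rightarrow> (real + nat) option" where
    "\<sigma> j = (case j of Inl a \<Rightarrow> Some (Inl a) | Inr n \<Rightarrow> (case n of 0 \<Rightarrow> None | Suc m \<Rightarrow> Some (Inr m)))" for j
  have Inr: "(\<lambda>n. extend \<sigma> E x (Inr n)) = shift_env x (\<lambda>n. E (Inr n))" for E x
    by (auto simp: extend_def \<sigma>_def shift_env_def split: nat.split)
  have Inl: "extend \<sigma> E x (Inl a) = E (Inl a)" for E x a
    by (simp add: extend_def \<sigma>_def)
  have "sign_determined (\<lambda>E. \<not> (\<exists>x. \<not> holds (\<lambda>n. extend \<sigma> E x (Inr n)) (map_scal_fm (\<lambda>a. extend \<sigma> E x (Inl a)) p)))"
    using All by (intro sign_determined_not sign_determined_ex[where P = "\<lambda>E. \<not> holds (\<lambda>n. E (Inr n)) (map_scal_fm (\<lambda>a. E (Inl a)) p)"]) simp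
  then show ?case by (simp add: Inr Inl)
qed

section \<open>Transport of proofs along renamings\<close>

text \<open>\<open>h\<close> is quantified for a given \<open>S\<close> because it can be chosen
  only once the axioms used are known. Closedness of \<open>\<Gamma>'\<close> is what generalization
  demands.\<close>

definition translatable :: "fsym set \<Rightarrow> fm set \<Rightarrow> fm \<Rightarrow> bool" where
  "translatable L S p \<longleftrightarrow> (\<forall>h L' \<Gamma>'. map_fsym h ` L \<subseteq> L' \<longrightarrow>
     (\<forall>q\<in>\<Gamma>'. closed_fm 0 q) \<longrightarrow> map_scal_fm h ` S \<subseteq> \<Gamma>' \<longrightarrow> prov L' \<Gamma>' (map_scal_fm h p))"

lemma translatable_MP:
  assumes "translatable L S (Imp p q)" "translatable L S' p"
  shows "translatable L (S \<union> S') q"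
  unfolding translatable_def
proof (intro allI impI)
  fix h L' \<Gamma>'
  assume *: "map_fsym h ` L \<subseteq> L'" "\<forall>q\<in>\<Gamma>'. closed_fm 0 q" "map_scal_fm h ` (S \<union> S') \<subseteq> \<Gamma>'"
  then have "prov L' \<Gamma>' (map_scal_fm h (Imp p q))" "prov L' \<Gamma>' (map_scal_fm h p)"
    using assms unfolding translatable_def by (simp_all add: image_Un)
  then show "prov L' \<Gamma>' (map_scal_fm h q)" by (auto intro: prov.MP)
qed

text \<open>Finiteness and renaming are proved in one induction. The axiom schemes are stable
  because renaming commutes with lifting and substitution and preserves well-formedness.\<close>

lemma prov_imp_translatable:
  assumes "prov L \<Gamma> p"
  shows "\<exists>S. finite S \<and> S \<subseteq> \<Gamma> \<and> (\<forall>q\<in>S. wf_fm L q) \<and> translatable L S p"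
  using assms
proof (induction rule: prov.induct)
  case (Hyp p \<Gamma>)
  then show ?case
    by (intro exI[of _ "{p}"]) (auto simp: translatable_def intro!: prov.Hyp wf_map_scal_fm)
next
  case (MP \<Gamma> p q)
  from MP.IH obtain S S' where "finite S" "S \<subseteq> \<Gamma>" "\<forall>q\<in>S. wf_fm L q" "translatable L S (Imp p q)"
    "finite S'" "S' \<subseteq> \<Gamma>" "\<forall>q\<in>S'. wf_fm L q" "translatable L S' p" by (elim exE conjE)
  then show ?case by (intro exI[of _ "S \<union> S'"]) (auto intro: translatable_MP)
next
  case (Gen \<Gamma> p)
  from Gen.IH obtain S where "finite S" "S \<subseteq> \<Gamma>" "\<forall>q\<in>S. wf_fm L q" "translatable L S p" by (elim exE conjE)
  then show ?case by (intro exI[of _ S]) (simp add: translatable_def prov.Gen)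
qed (intro exI[of _ "{}"], simp add: translatable_def map_scal_subst_fm map_scal_lift_fm,
    intro allI impI prov.intros(2-4,7-) wf_map_scal_fm wf_map_scal_trm, assumption+)+

text \<open>Read as coordinates, the original scalars satisfy the sentences of \<open>S\<close>; an
  algebraic point of the same condition provides \<open>h\<close>. Only the coordinates in
  \<open>K\<close> matter, since the sentences are closed.\<close>

theorem algebraic_scalars:
  assumes S: "finite S" "\<And>q. q \<in> S \<Longrightarrow> wf_fm L q \<and> closed_fm 0 q \<and> (\<forall>e. holds e q)"
  shows "\<exists>h. (\<forall>a. algebraic (h a)) \<and> (\<forall>a. algebraic a \<longrightarrow> h a = a) \<and>
    (\<forall>q\<in>S. \<forall>e. holds e (map_scal_fm h q))"
proof -
  define K where "K = (\<Union>q\<in>S. scals_fm q)"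
  have K: "finite K" using S(1) by (simp add: K_def finite_scals_fm)
  define T where "T E q = holds (\<lambda>n. E (Inr n)) (map_scal_fm (\<lambda>a. E (Inl a)) q)"
    for E :: "real + nat \<Rightarrow> real" and q
  \<comment> \<open>The second conjunct pins every algebraic scalar in \<open>K\<close> to its own
    value.\<close>
  define P where "P E \<longleftrightarrow> (\<forall>q\<in>S. T E q) \<and> (\<forall>a\<in>{a \<in> K. algebraic a}. E (Inl a) = a)" for E
  have "\<exists>E. P E \<and> (\<forall>i\<in>Inl ` K. algebraic (E i))"
  proof (rule exists_algebraic_point[where e = "case_sum (\<lambda>a. a) (\<lambda>_. 0)" and I = "Inl ` K"])
    have "sign_determined (\<lambda>E. \<forall>q\<in>S. T E q)" unfolding T_def
      using S by (intro sign_determined_Ball) (auto intro: sign_determined_holds)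
    moreover have "sign_determined (\<lambda>E :: real + nat \<Rightarrow> real. \<forall>a\<in>{a \<in> K. algebraic a}. E (Inl a) = a)"
      using K by (intro sign_determined_Ball) (auto intro: sign_determined_eq_algebraic)
    ultimately show "sign_determined P" unfolding P_def
      by (intro sign_determined_binary[where b = "(\<and>)"])
    show "P (case_sum (\<lambda>a. a) (\<lambda>_. 0))"
      using S(2) by (auto simp: P_def T_def map_scal_fm_id)
  next
    fix E E' :: "real + nat \<Rightarrow> real" assume eq: "\<And>i. i \<in> Inl ` K \<Longrightarrow> E i = E' i"
    have "T E q = T E' q" if "q \<in> S" for q
    proof -
      have "map_scal_fm (\<lambda>a. E (Inl a)) q = map_scal_fm (\<lambda>a. E' (Inl a)) q"
        using that eq by (intro map_scal_fm_cong) (auto simp: K_def)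
      then show ?thesis unfolding T_def
        using S(2)[OF that] by (auto intro!: holds_closed[of 0] simp: closed_map_scal_fm)
    qed
    moreover have "E (Inl a) = E' (Inl a)" if "a \<in> K" for a using that eq by auto
    ultimately show "P E = P E'" unfolding P_def by simp
  qed (use K in auto)
  then obtain E where E: "P E" "\<And>a. a \<in> K \<Longrightarrow> algebraic (E (Inl a))" by blast
  \<comment> \<open>Outside \<open>K\<close> the sentences impose nothing; the default
    \<open>0\<close> makes the remaining values algebraic.\<close>
  define h where "h a = (if a \<in> K then E (Inl a) else if algebraic a then a else 0)" for a
  have "holds e (map_scal_fm h q)" if "q \<in> S" for e q
  proof -
    have "map_scal_fm h q = map_scal_fm (\<lambda>a. E (Inl a)) q"
      using that by (intro map_scal_fm_cong) (auto simp: K_def h_def)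
    moreover have "T E q" using E(1) that by (simp add: P_def)
    moreover have "closed_fm 0 (map_scal_fm h q)" using S(2)[OF that] by (simp add: closed_map_scal_fm)
    ultimately show ?thesis
      using holds_closed[of 0 "map_scal_fm h q" e "\<lambda>n. E (Inr n)"] by (simp add: T_def)
  qed
  moreover have "algebraic (h a)" for a using E(2) by (simp add: h_def)
  moreover have "h a = a" if "algebraic a" for a using E(1) that by (simp add: h_def P_def)
  ultimately show ?thesis by blast
qed

theorem theorem4p4:
  fixes p :: fm
  assumes "sentence (L_full real_alg) p"
    and "prov (L_full UNIV) (T_full UNIV) p"
  shows "prov (L_full real_alg) (T_full real_alg) p"
proof -
  have closed: "\<forall>q\<in>T_full F. closed_fm 0 q" for F
    by (auto simp: T_full_def T_add_def T_mult_def sentence_def)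
  obtain S where S: "finite S" "S \<subseteq> T_full UNIV" "\<forall>q\<in>S. wf_fm (L_full UNIV) q"
    and translatable: "translatable (L_full UNIV) S p"
    using prov_imp_translatable[OF assms(2)] by blast
  have "\<exists>h. (\<forall>a. algebraic (h a)) \<and> (\<forall>a. algebraic a \<longrightarrow> h a = a) \<and>
    (\<forall>q\<in>S. \<forall>e. holds e (map_scal_fm h q))"
    using S by (intro algebraic_scalars[where L = "L_full UNIV"])
      (auto simp: T_full_def T_add_def T_mult_def sentence_def)
  then obtain h where h: "\<And>a. algebraic (h a)" "\<And>a. algebraic a \<Longrightarrow> h a = a"
    "\<And>q e. q \<in> S \<Longrightarrow> holds e (map_scal_fm h q)" by blast
  \<comment> \<open>Renaming stays within the additive or the multiplicative language, so a renamed
    axiom that is still true is an axiom of the same half.\<close>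
  have L: "map_fsym h ` L_add UNIV \<subseteq> L_add real_alg" "map_fsym h ` L_mult UNIV \<subseteq> L_mult real_alg"
    using h(1) by (auto simp: L_add_def L_mult_def real_alg_def)
  have mem: "map_scal_fm h q \<in> T_full real_alg" if "q \<in> S" for q
    using S(2) that h(3)[OF that] wf_map_scal_fm[OF _ L(1)] wf_map_scal_fm[OF _ L(2)]
    by (auto simp: T_full_def T_add_def T_mult_def sentence_def closed_map_scal_fm)
  have "map_fsym h ` L_full UNIV \<subseteq> L_full real_alg" using L by (auto simp: L_full_def)
  moreover have "map_scal_fm h ` S \<subseteq> T_full real_alg" using mem by blast
  ultimately have "prov (L_full real_alg) (T_full real_alg) (map_scal_fm h p)"
    using translatable closed[of real_alg] by (simp add: translatable_def)
  \<comment> \<open>All scalars of \<open>p\<close> are algebraic, hence fixed by \<open>h\<close>: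
    the transported proof proves \<open>p\<close> itself.\<close>
  moreover have "map_scal_fm h p = map_scal_fm (\<lambda>a. a) p"
    using scals_fm_subset[of "L_full real_alg" p] assms(1) h(2)
    by (intro map_scal_fm_cong) (auto simp: sentence_def L_full_def L_add_def L_mult_def real_alg_def)
  ultimately show ?thesis by (simp add: map_scal_fm_id)
qed

end
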